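(* For all $r,q\in\mathbb{N}$ with $r,q\ge 2$ and all $\mu>0$, there exists $\varepsilon>0$ such that the following holds for all sufficiently large $n$. Let $G$ be an $n$-vertex $r$-graph whose edges are $q$-coloured and assume that $e(G)\ge(1-\varepsilon)\binom{n}{r}$. Then $G$ contains a monochromatic matching of size at least $(1-\mu)\frac{n}{r+q-1}$.
   Context: An $r$-graph is an $r$-uniform hypergraph, and $e(G)$ is its number of edges. The edges are $q$-coloured if each edge is assigned one of $q$ colours (arbitrarily). A matching is a set of pairwise disjoint edges, its size is its number of edges, and it is monochromatic if all its edges have the same colour. *)

theory Defs
  imports Complex_Main
begin

definition r_graph :: "nat \<Rightarrow> 'v set \<Rightarrow> 'v set set \<Rightarrow> bool" where
  "r_graph r V E \<longleftrightarrow> finite V \<and> (\<forall>e\<in>E. e \<subseteq> V \<and> card e = r)"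

text \<open>The colours are \<open>0, \<dots>, q - 1\<close>; only the values on \<open>E\<close> matter, and not every colour need occur.\<close>

definition edge_colouring :: "nat \<Rightarrow> 'v set set \<Rightarrow> ('v set \<Rightarrow> nat) \<Rightarrow> bool" where
  "edge_colouring q E c \<longleftrightarrow> (\<forall>e\<in>E. c e < q)"

definition matching :: "'v set set \<Rightarrow> 'v set set \<Rightarrow> bool" where
  "matching E M \<longleftrightarrow> M \<subseteq> E \<and> pairwise disjnt M"

definition monochromatic :: "('v set \<Rightarrow> nat) \<Rightarrow> 'v set set \<Rightarrow> bool" where
  "monochromatic c M \<longleftrightarrow> (\<forall>e\<in>M. \<forall>f\<in>M. c e = c f)"

end

theory Submission
  imports Defs "HOL-Library.FuncSet" "HOL-Library.Disjoint_Sets"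
begin

text \<open>
  The matching is first built fractionally, one colour class at a time gaining a dense piece, and is rounded
  only at the end. The pieces are tuples \<open>W\<close> of \<open>r\<close> disjoint vertex sets of a common size, linear in \<open>n\<close>,
  such that any large subsets of the parts span an edge of one fixed colour. Such a tuple is found inside every
  dense \<open>r\<close>-partite hypergraph by a density increment (\<open>hereditary_subtuple\<close>). Inside it the greedy algorithm
  finds an almost perfect matching, even after the parts have been thinned out. Hence a bounded number of
  tuples of one colour that cover each vertex at most \<open>K\<close> times, with sizes adding up to \<open>S\<close>, yields a
  matching of size about \<open>S / K\<close>: share out each vertex among the tuples that contain it
  (\<open>matching_from_rich_tuples\<close>).

  It remains to reach \<open>S\<close> close to \<open>K * n / (r + q - 1)\<close> in some colour while no vertex is covered more than
  \<open>K\<close> times. The tuples are chosen in rounds, guided by multiplicative weights. A vertex covered \<open>N\<close> times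
  in colour \<open>i\<close> has weight \<open>b ^ N\<close> in that colour, where \<open>b\<close> is slightly larger than \<open>1\<close>. As long as few
  vertices have been covered \<open>K\<close> times in some colour, there are \<open>r\<close> large classes of vertices, constant
  in all weights, such that for every colour the \<open>r\<close> weights sum to at most about \<open>r + q - 1\<close> times the
  average weight of that colour (\<open>light_classes\<close>). This is a convexity argument: a distribution on points of
  the \<open>q\<close>-dimensional positive orthant may be reduced to \<open>q\<close> points without raising any coordinate of its mean, and
  rounding down \<open>r + q - 1\<close> times its weights leaves at least \<open>r\<close> points (\<open>light_selection\<close>). As the hypergraph
  is almost complete, some colour is dense between these classes, and the new tuple is taken there.

  A tuple of size \<open>w\<close> then multiplies the total weight of its colour by at most about
  \<open>1 + (b - 1) * (r + q - 1) * w / n\<close> (\<open>extend_admissible\<close>). While the sizes in colour \<open>i\<close> add up to at most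
  \<open>(1 - \<sigma>) * K * n / (r + q - 1)\<close>, the average weight in colour \<open>i\<close> is therefore at most about
  \<open>exp ((1 - \<sigma>) * K * (b - 1))\<close>, far below the weight \<open>b ^ K\<close> of a vertex covered \<open>K\<close> times. So few
  vertices are covered \<open>K\<close> times, and the rounds can go on until some colour exceeds this bound.
\<close>

section \<open>Tuples of vertex sets that span edges hereditarily\<close>

text \<open>
  An edge with one vertex in each of the sets \<open>A 0, \<dots>, A (r - 1)\<close> is recorded by its choice function, so
  that densities are measured against the box \<open>PiE {..<r} A\<close>.
\<close>

definition transversals :: "nat \<Rightarrow> 'v set set \<Rightarrow> (nat \<Rightarrow> 'v set) \<Rightarrow> (nat \<Rightarrow> 'v) set" where
  "transversals r F A = {a \<in> PiE {..<r} A. a ` {..<r} \<in> F}"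

text \<open>
  The sets \<open>X j\<close> contain at least the fraction \<open>1 / h\<close> of the \<open>w\<close> vertices in the part \<open>W j\<close>. This
  one-sided fragment of regularity is all that a greedy matching needs.
\<close>

definition hereditary :: "nat \<Rightarrow> nat \<Rightarrow> 'v set set \<Rightarrow> nat \<Rightarrow> (nat \<Rightarrow> 'v set) \<Rightarrow> bool" where
  "hereditary r h F w W \<longleftrightarrow>
    (\<forall>X. (\<forall>j<r. X j \<subseteq> W j \<and> w \<le> h * card (X j)) \<longrightarrow> transversals r F X \<noteq> {})"

lemma transversals_subset_PiE: "transversals r F A \<subseteq> PiE {..<r} A"
  by (auto simp: transversals_def)

lemma finite_transversals:
  assumes "\<And>j. j < r \<Longrightarrow> finite (A j)"
  shows "finite (transversals r F A)"
  by (rule finite_subset[OF transversals_subset_PiE]) (auto intro: finite_PiE assms)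

text \<open>
  Used to cut a part into \<open>h\<close> pieces of which one is prescribed.
\<close>

lemma equal_cover_containing:
  assumes "finite A" "card A = h * k" "X \<subseteq> A" "card X = k" "1 \<le> h"
  shows "\<exists>B. B 0 = X \<and> (\<forall>l<h. B l \<subseteq> A \<and> card (B l) = k) \<and> A \<subseteq> (\<Union>l<h. B l)"
  using assms(5,1-4)
proof (induction h arbitrary: A X rule: dec_induct)
  case base
  then have "X = A" by (simp add: card_subset_eq)
  with base show ?case by (intro exI[of _ "\<lambda>_. X"]) auto
next
  case (step h)
  have c: "card (A - X) = h * k"
    using step by (simp add: card_Diff_subset finite_subset)
  have "k \<le> card (A - X)" using step.hyps by (simp add: c)
  then obtain X' where X': "X' \<subseteq> A - X" "card X' = k"
    by (meson obtain_subset_with_card_n)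
  obtain B where B: "B 0 = X'" "\<forall>l<h. B l \<subseteq> A - X \<and> card (B l) = k" "A - X \<subseteq> (\<Union>l<h. B l)"
    using step.IH[of "A - X" X'] c X' step.prems by auto
  let ?B = "\<lambda>l. case l of 0 \<Rightarrow> X | Suc l' \<Rightarrow> B l'"
  have "A \<subseteq> (\<Union>l<Suc h. ?B l)"
  proof
    fix x assume "x \<in> A"
    show "x \<in> (\<Union>l<Suc h. ?B l)"
    proof (cases "x \<in> X")
      case True
      then show ?thesis by (intro UN_I[of 0]) auto
    next
      case False
      then obtain l where "l < h" "x \<in> B l" using B(3) \<open>x \<in> A\<close> by auto
      then show ?thesis by (intro UN_I[of "Suc l"]) auto
    qed
  qed
  moreover have "\<forall>l<Suc h. ?B l \<subseteq> A \<and> card (?B l) = k"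
    using B(2) step.prems by (auto split: nat.splits)
  ultimately show ?case by (intro exI[of _ ?B]) auto
qed

text \<open>
  A density increment. If \<open>A\<close> itself fails, the failure gives an empty sub-box whose sides are the fraction
  \<open>1 / h\<close> of those of \<open>A\<close>. Extending it to a grid of \<open>h ^ r\<close> congruent boxes, the edges are spread
  over only \<open>h ^ r - 1\<close> of them, so one of these is denser than \<open>A\<close> by at least the
  factor \<open>h ^ r / (h ^ r - 1)\<close>. A density never exceeds \<open>1\<close>, so fewer than \<open>P\<close> increments are possible when
  \<open>P\<close> satisfies the last hypothesis.
\<close>

lemma hereditary_subtuple:
  fixes d :: real
  assumes "1 \<le> r" "2 \<le> h" "1 \<le> m"
    and "\<And>j. j < r \<Longrightarrow> finite (A j)" "\<And>j. j < r \<Longrightarrow> card (A j) = m * h ^ P"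
    and "d * real (m * h ^ P) ^ r \<le> real (card (transversals r F A))"
    and "1 < d * (real h ^ r / (real h ^ r - 1)) ^ P"
  shows "\<exists>p W. p \<le> P \<and> (\<forall>j<r. W j \<subseteq> A j \<and> card (W j) = m * h ^ p) \<and> hereditary r h F (m * h ^ p) W"
  using assms(4-7)
proof (induction P arbitrary: A d)
  case 0
  have "card (transversals r F A) \<le> card (PiE {..<r} A)"
    by (intro card_mono transversals_subset_PiE finite_PiE) (use 0 in auto)
  also have "\<dots> = m ^ r" using 0 by (simp add: card_PiE)
  finally have "d * real m ^ r \<le> real m ^ r" using "0.prems"(3)
    by simp (metis (no_types, lifting) of_nat_le_iff of_nat_power order_trans)
  then have "d \<le> 1" using \<open>1 \<le> m\<close> by (simp add: mult_le_cancel_right1)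
  then show ?case using 0 by simp
next
  case (Suc P)
  show ?case
  proof (cases "hereditary r h F (m * h ^ Suc P) A")
    case True
    then show ?thesis using Suc.prems by (intro exI[of _ "Suc P"] exI[of _ A]) auto
  next
    case False
    then obtain X0 where X0: "\<And>j. j < r \<Longrightarrow> X0 j \<subseteq> A j \<and> m * h ^ Suc P \<le> h * card (X0 j)"
      "transversals r F X0 = {}"
      by (auto simp: hereditary_def)
    let ?k = "m * h ^ P"
    have "\<exists>B. B 0 \<subseteq> X0 j \<and> (\<forall>l<h. B l \<subseteq> A j \<and> card (B l) = ?k) \<and> A j \<subseteq> (\<Union>l<h. B l)" if "j < r" for j
    proof -
      have "h * ?k \<le> h * card (X0 j)" using X0(1)[OF that] by (simp add: mult.left_commute)
      then have "?k \<le> card (X0 j)" using \<open>2 \<le> h\<close> by (simp del: mult_le_cancel1 add: mult_le_cancel1)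
      then obtain X where X: "X \<subseteq> X0 j" "card X = ?k" by (meson obtain_subset_with_card_n)
      have "\<exists>B. B 0 = X \<and> (\<forall>l<h. B l \<subseteq> A j \<and> card (B l) = ?k) \<and> A j \<subseteq> (\<Union>l<h. B l)"
      proof (rule equal_cover_containing)
        show "X \<subseteq> A j" using X(1) X0(1)[OF that] by blast
      qed (use Suc.prems(1,2)[OF that] X(2) \<open>2 \<le> h\<close> in auto)
      then show ?thesis using X by metis
    qed
    then obtain B where B: "\<And>j. j < r \<Longrightarrow> B j 0 \<subseteq> X0 j"
      "\<And>j l. j < r \<Longrightarrow> l < h \<Longrightarrow> B j l \<subseteq> A j \<and> card (B j l) = ?k"
      "\<And>j. j < r \<Longrightarrow> A j \<subseteq> (\<Union>l<h. B j l)"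
      by metis
    \<comment> \<open>The grid: \<open>g\<close> selects the box with sides \<open>B j (g j)\<close>, and the constant \<open>0\<close> selects the empty box.\<close>
    let ?G = "PiE {..<r} (\<lambda>_. {..<h})"
    let ?z = "\<lambda>j\<in>{..<r}. 0::nat"
    let ?box = "\<lambda>g j. B j (g j)"
    have finG: "finite ?G" by (intro finite_PiE) auto
    have cG: "card ?G = h ^ r" by (simp add: card_PiE)
    have zG: "?z \<in> ?G" using \<open>2 \<le> h\<close> by auto
    have z0: "transversals r F (?box ?z) = {}"
    proof -
      have "PiE {..<r} (?box ?z) \<subseteq> PiE {..<r} X0" by (rule PiE_mono) (simp add: B(1))
      then have "transversals r F (?box ?z) \<subseteq> transversals r F X0" unfolding transversals_def by blast
      then show ?thesis using X0(2) by blast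
    qed
    have finbox: "finite (transversals r F (?box g))" if "g \<in> ?G" for g
    proof (rule finite_transversals)
      fix j assume "j < r"
      then have "B j (g j) \<subseteq> A j" using B(2) PiE_mem[OF that, of j] by simp
      then show "finite (B j (g j))" using Suc.prems(1)[OF \<open>j < r\<close>] finite_subset by blast
    qed
    have cover: "transversals r F A \<subseteq> (\<Union>g\<in>?G - {?z}. transversals r F (?box g))"
    proof
      fix a assume a: "a \<in> transversals r F A"
      then have aA: "a \<in> PiE {..<r} A" "a ` {..<r} \<in> F" by (simp_all add: transversals_def)
      have "\<exists>l<h. a j \<in> B j l" if "j < r" for j using PiE_mem[OF aA(1), of j] B(3)[OF that] that by auto
      then obtain g where g: "\<And>j. j < r \<Longrightarrow> g j < h \<and> a j \<in> B j (g j)" by metis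
      let ?g = "restrict g {..<r}"
      have gG: "?g \<in> ?G" using g by simp
      have "a \<in> PiE {..<r} (?box ?g)"
        using g aA(1) by (intro PiE_I) (auto simp: PiE_def extensional_def)
      then have ag: "a \<in> transversals r F (?box ?g)" using aA(2) by (simp add: transversals_def)
      have "?g \<noteq> ?z"
      proof
        assume eq: "?g = ?z"
        show False using ag unfolding eq z0 by (rule emptyE)
      qed
      then show "a \<in> (\<Union>g\<in>?G - {?z}. transversals r F (?box g))" using gG ag by blast
    qed
    have hr: "real h ^ r > 1" using \<open>1 \<le> r\<close> \<open>2 \<le> h\<close> by (simp add: one_less_power)
    let ?d = "d * (real h ^ r / (real h ^ r - 1))"
    have "\<exists>g\<in>?G - {?z}. ?d * real ?k ^ r \<le> real (card (transversals r F (?box g)))"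
    proof (rule ccontr)
      assume sparse: "\<not> ?thesis"
      have lt: "real (card (transversals r F (?box g))) < ?d * real ?k ^ r" if "g \<in> ?G - {?z}" for g
        by (rule ccontr, rule notE[OF sparse], rule bexI[OF _ that], rule leI)
      have ne: "?G - {?z} \<noteq> {}"
      proof
        assume "?G - {?z} = {}"
        then have "?G \<subseteq> {?z}" by blast
        then have "card ?G \<le> card {?z}" by (rule card_mono[rotated]) simp
        then have "h ^ r \<le> 1" using cG by simp
        then have "real (h ^ r) \<le> real 1" by (simp only: of_nat_le_iff)
        then show False using hr by simp
      qed
      have "real (card (transversals r F A)) \<le> real (card (\<Union>g\<in>?G - {?z}. transversals r F (?box g)))"
        by (simp only: of_nat_le_iff, rule card_mono[OF _ cover]) (use finG finbox in blast)
      also have "\<dots> \<le> (\<Sum>g\<in>?G - {?z}. real (card (transversals r F (?box g))))"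
        unfolding of_nat_sum[symmetric] of_nat_le_iff by (rule card_UN_le) (use finG in auto)
      also have "\<dots> < (\<Sum>g\<in>?G - {?z}. ?d * real ?k ^ r)"
        by (rule sum_strict_mono) (use finG ne lt in auto)
      also have "\<dots> = (real h ^ r - 1) * (?d * real ?k ^ r)"
      proof -
        have "1 \<le> h ^ r" using \<open>2 \<le> h\<close> by simp
        then have "real (card (?G - {?z})) = real h ^ r - 1"
          unfolding card_Diff_singleton[OF zG] cG by (simp add: of_nat_diff)
        then show ?thesis by (simp only: sum_constant)
      qed
      also have "\<dots> = d * real (m * h ^ Suc P) ^ r"
        using hr by (simp add: field_simps power_mult_distrib)
      finally show False using Suc.prems(3) by simp
    qed
    then obtain g where g: "g \<in> ?G" "?d * real ?k ^ r \<le> real (card (transversals r F (?box g)))" by blast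
    have gh: "g j < h" if "j < r" for j using g(1) that by auto
    have "1 < ?d * (real h ^ r / (real h ^ r - 1)) ^ P" using Suc.prems(4) by (simp add: mult_ac)
    moreover have "B j (g j) \<subseteq> A j \<and> card (B j (g j)) = ?k" if "j < r" for j
      by (rule B(2)[OF that gh[OF that]])
    moreover from this have "finite (B j (g j))" if "j < r" for j
      using Suc.prems(1)[OF that] finite_subset that by blast
    ultimately obtain p W where "p \<le> P" "\<forall>j<r. W j \<subseteq> B j (g j) \<and> card (W j) = m * h ^ p"
        "hereditary r h F (m * h ^ p) W"
      using Suc.IH[of "?box g" ?d] g(2) by blast
    moreover have "W j \<subseteq> A j" if "j < r" for j using calculation(2) B(2)[OF that gh[OF that]] that by blast
    ultimately show ?thesis by (intro exI[of _ p] exI[of _ W]) auto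
  qed
qed

text \<open>
  Remove the vertices of one edge after another; this can only stop when some part has fewer than \<open>k\<close>
  vertices left. The nonemptiness of the edges is recorded because it makes matchings that are built inside
  disjoint sets share no edge.
\<close>

lemma greedy_matching:
  assumes "1 \<le> r" "\<And>j. j < r \<Longrightarrow> finite (Y j)" "disjoint_family_on Y {..<r}"
    and "\<And>j. j < r \<Longrightarrow> y \<le> card (Y j)"
    and "\<And>X. (\<And>j. j < r \<Longrightarrow> X j \<subseteq> Y j \<and> k \<le> card (X j)) \<Longrightarrow> transversals r F X \<noteq> {}"
  shows "\<exists>M. M \<subseteq> F \<and> finite M \<and> pairwise disjnt M \<and> (\<forall>e\<in>M. e \<noteq> {} \<and> e \<subseteq> (\<Union>j<r. Y j)) \<and> y \<le> card M + k"
  using assms(2-5)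
proof (induction y arbitrary: Y)
  case 0
  show ?case by (intro exI[of _ "{}"]) auto
next
  case (Suc y)
  show ?case
  proof (cases "Suc y \<le> k")
    case True
    then show ?thesis by (intro exI[of _ "{}"]) auto
  next
    case False
    have "transversals r F Y \<noteq> {}"
      by (rule Suc.prems(4)) (use Suc.prems(3) False in \<open>force\<close>)
    then obtain a where a: "\<And>j. j < r \<Longrightarrow> a j \<in> Y j" "a ` {..<r} \<in> F"
      by (auto simp: transversals_def)
    let ?Y = "\<lambda>j. Y j - {a j}"
    have "\<exists>M. M \<subseteq> F \<and> finite M \<and> pairwise disjnt M \<and> (\<forall>e\<in>M. e \<noteq> {} \<and> e \<subseteq> (\<Union>j<r. ?Y j)) \<and> y \<le> card M + k"
    proof (rule Suc.IH)
      show "disjoint_family_on ?Y {..<r}" using Suc.prems(2) by (auto simp: disjoint_family_on_def)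
      show "y \<le> card (?Y j)" if "j < r" for j using Suc.prems(1,3)[OF that] a(1)[OF that] by simp
      show "transversals r F X \<noteq> {}" if "\<And>j. j < r \<Longrightarrow> X j \<subseteq> ?Y j \<and> k \<le> card (X j)" for X
        by (rule Suc.prems(4)) (use that in blast)
    qed (use Suc.prems in auto)
    then obtain M where M: "M \<subseteq> F" "finite M" "pairwise disjnt M" "\<forall>e\<in>M. e \<noteq> {} \<and> e \<subseteq> (\<Union>j<r. ?Y j)" "y \<le> card M + k"
      by blast
    let ?e = "a ` {..<r}"
    have ene: "?e \<noteq> {}" using \<open>1 \<le> r\<close> by (auto simp: lessThan_empty_iff)
    have "?e \<inter> (\<Union>j<r. ?Y j) = {}"
    proof (rule equals0I)
      fix x assume "x \<in> ?e \<inter> (\<Union>j<r. ?Y j)"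
      then obtain i j where "i < r" "j < r" "x = a i" "x \<in> Y j" "x \<noteq> a j" by auto
      then show False using a(1) Suc.prems(2) by (metis IntI disjoint_family_on_def empty_iff lessThan_iff)
    qed
    then have dis: "\<forall>f\<in>M. disjnt ?e f" using M(4) unfolding disjnt_def by blast
    have "?e \<notin> M" using dis ene by (metis disjnt_self_iff_empty)
    have "?e \<subseteq> (\<Union>j<r. Y j)" "(\<Union>j<r. ?Y j) \<subseteq> (\<Union>j<r. Y j)" using a(1) by auto
    then have "\<forall>e\<in>insert ?e M. e \<noteq> {} \<and> e \<subseteq> (\<Union>j<r. Y j)"
      using M(4) ene by (metis (no_types, lifting) insert_iff order_trans)
    moreover have "pairwise disjnt (insert ?e M)"
      using M(3) dis by (auto simp: pairwise_insert disjnt_sym)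
    moreover have "card (insert ?e M) = Suc (card M)" using \<open>?e \<notin> M\<close> M(2) by simp
    ultimately show ?thesis using M(1,2,5) a(2) by (intro exI[of _ "insert ?e M"]) auto
  qed
qed

section \<open>Rounding sets of bounded overlap to disjoint sets\<close>

lemma disjoint_subsets_of_card:
  assumes "finite S" "finite B" "card S * k \<le> card B"
  shows "\<exists>Q. disjoint_family_on Q S \<and> (\<forall>x\<in>S. Q x \<subseteq> B \<and> card (Q x) = k)"
  using assms
proof (induction S arbitrary: B rule: finite_induct)
  case empty
  then show ?case by (auto simp: disjoint_family_on_def)
next
  case (insert x S)
  then have "k \<le> card B" by simp
  then obtain Z where Z: "Z \<subseteq> B" "card Z = k" by (meson obtain_subset_with_card_n)
  have "card S * k \<le> card (B - Z)" using insert Z by (simp add: card_Diff_subset finite_subset)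
  then obtain Q where Q: "disjoint_family_on Q S" "\<forall>x\<in>S. Q x \<subseteq> B - Z \<and> card (Q x) = k"
    using insert.IH[of "B - Z"] insert.prems by auto
  let ?Q = "\<lambda>y. if y = x then Z else Q y"
  have "Z \<inter> Q y = {}" if "y \<in> S" for y using Q(2) that by blast
  then have "disjoint_family_on ?Q (insert x S)"
    using Q(1) by (auto simp: disjoint_family_on_def)
  moreover have "\<forall>y\<in>insert x S. ?Q y \<subseteq> B \<and> card (?Q y) = k" using Q(2) Z by auto
  ultimately show ?case by (intro exI[of _ ?Q]) blast
qed

text \<open>
  Vertices are grouped by the set of indices \<open>x\<close> with \<open>v \<in> W x\<close>. In each of the at most
  \<open>2 ^ card J\<close> groups, each of the at most \<open>K\<close> indices receives the fraction \<open>1 / K\<close> of the vertices,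
  rounded down, and so falls short by less than one vertex per group. The loss depends on the number of sets only and not on their sizes.
\<close>

lemma split_bounded_overlap:
  assumes fin: "finite J" "\<And>x. x \<in> J \<Longrightarrow> finite (W x)" and "1 \<le> K"
    and load: "\<And>v. card {x \<in> J. v \<in> W x} \<le> K"
  shows "\<exists>Y. disjoint_family_on Y J \<and> (\<forall>x\<in>J. Y x \<subseteq> W x \<and> card (W x) \<le> K * (card (Y x) + 2 ^ card J))"
proof -
  define V where "V = (\<Union>x\<in>J. W x)"
  define sig where "sig v = {x \<in> J. v \<in> W x}" for v
  define cls where "cls S = {v \<in> V. sig v = S}" for S
  have finV: "finite V" using fin by (auto simp: V_def)
  have fincls: "finite (cls S)" for S using finV by (auto simp: cls_def)
  have "\<exists>Q. disjoint_family_on Q S \<and> (\<forall>x\<in>S. Q x \<subseteq> cls S \<and> card (cls S) \<le> K * (card (Q x) + 1))"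
    if "S \<subseteq> J" for S
  proof (cases "cls S = {}")
    case True
    then show ?thesis by (intro exI[of _ "\<lambda>_. {}"]) (auto simp: disjoint_family_on_def)
  next
    case False
    then have "card S \<le> K" using load by (auto simp: cls_def sig_def)
    then have "card S * (card (cls S) div K) \<le> card (cls S)"
      by (meson mult_le_mono1 order_trans times_div_less_eq_dividend)
    then obtain Q where Q: "disjoint_family_on Q S" "\<forall>x\<in>S. Q x \<subseteq> cls S \<and> card (Q x) = card (cls S) div K"
      using disjoint_subsets_of_card[of S "cls S"] fincls fin(1) \<open>S \<subseteq> J\<close> finite_subset by metis
    have "card (cls S) \<le> K * (card (cls S) div K + 1)"
      using \<open>1 \<le> K\<close> by (simp add: dividend_less_times_div less_imp_le)
    then show ?thesis using Q by (intro exI[of _ Q]) (metis)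
  qed
  then obtain Q where Q: "\<And>S. S \<subseteq> J \<Longrightarrow> disjoint_family_on (Q S) S"
     "\<And>S x. S \<subseteq> J \<Longrightarrow> x \<in> S \<Longrightarrow> Q S x \<subseteq> cls S \<and> card (cls S) \<le> K * (card (Q S x) + 1)"
    by metis
  define Y where "Y x = (\<Union>S\<in>{S\<in>Pow J. x \<in> S}. Q S x)" for x
  have cls_disj: "S = S'" if "v \<in> cls S" "v \<in> cls S'" for v S S' using that by (simp add: cls_def)
  have "disjoint_family_on Y J"
    unfolding disjoint_family_on_def
  proof (intro ballI impI equals0I)
    fix x x' v assume "x \<in> J" "x' \<in> J" "x \<noteq> x'" "v \<in> Y x \<inter> Y x'"
    then obtain S S' where S: "S \<subseteq> J" "x \<in> S" "v \<in> Q S x" "S' \<subseteq> J" "x' \<in> S'" "v \<in> Q S' x'"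
      by (auto simp: Y_def)
    then have "S = S'" using Q(2) cls_disj by (meson subsetD)
    then show False using S Q(1)[of S] \<open>x \<noteq> x'\<close> by (auto simp: disjoint_family_on_def)
  qed
  moreover have "Y x \<subseteq> W x" if "x \<in> J" for x
  proof
    fix v assume "v \<in> Y x"
    then obtain S where "S \<subseteq> J" "x \<in> S" "v \<in> Q S x" by (auto simp: Y_def)
    then have "x \<in> sig v" using Q(2) by (auto simp: cls_def)
    then show "v \<in> W x" by (simp add: sig_def)
  qed
  moreover have "card (W x) \<le> K * (card (Y x) + 2 ^ card J)" if x: "x \<in> J" for x
  proof -
    let ?P = "{S\<in>Pow J. x \<in> S}"
    have finP: "finite ?P" using fin by auto
    have finQ: "finite (Q S x)" if "S \<in> ?P" for S using Q(2)[of S x] that finite_subset[OF _ fincls] by blast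
    have "W x \<subseteq> (\<Union>S\<in>?P. cls S)"
    proof
      fix v assume "v \<in> W x"
      then have "sig v \<in> ?P" "v \<in> cls (sig v)" using x by (auto simp: cls_def sig_def V_def)
      then show "v \<in> (\<Union>S\<in>?P. cls S)" by blast
    qed
    then have "card (W x) \<le> card (\<Union>S\<in>?P. cls S)"
      by (intro card_mono) (use finP fincls in auto)
    also have "\<dots> \<le> (\<Sum>S\<in>?P. card (cls S))" by (rule card_UN_le[OF finP])
    also have "\<dots> \<le> (\<Sum>S\<in>?P. K * (card (Q S x) + 1))"
      by (intro sum_mono) (use Q(2) in auto)
    also have "\<dots> = K * ((\<Sum>S\<in>?P. card (Q S x)) + card ?P)"
      by (simp add: sum.distrib distrib_left mult.commute flip: sum_distrib_left)
    also have "(\<Sum>S\<in>?P. card (Q S x)) = card (Y x)"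
      unfolding Y_def
    proof (rule card_UN_disjoint[symmetric, OF finP])
      show "\<forall>S\<in>?P. \<forall>S'\<in>?P. S \<noteq> S' \<longrightarrow> Q S x \<inter> Q S' x = {}"
      proof (intro ballI impI equals0I)
        fix S S' v assume "S \<in> ?P" "S' \<in> ?P" "S \<noteq> S'" "v \<in> Q S x \<inter> Q S' x"
        then have "v \<in> cls S" "v \<in> cls S'" using Q(2)[of S x] Q(2)[of S' x] by auto
        then show False using cls_disj \<open>S \<noteq> S'\<close> by blast
      qed
    qed (use finQ in blast)
    also have "card ?P \<le> card (Pow J)" by (intro card_mono) (use fin in auto)
    also have "card (Pow J) = 2 ^ card J" by (rule card_Pow[OF fin(1)])
    finally show ?thesis by simp
  qed
  ultimately show ?thesis by (intro exI[of _ Y]) auto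
qed

section \<open>Few points of small total weight\<close>

text \<open>
  Gaussian elimination on the matrix with rows \<open>u i\<close> and columns indexed by \<open>A\<close>.
\<close>

lemma linear_dependence:
  fixes u :: "nat \<Rightarrow> 'a \<Rightarrow> real"
  assumes "finite A" "q < card A"
  shows "\<exists>d. (\<exists>x\<in>A. d x \<noteq> 0) \<and> (\<forall>i<q. (\<Sum>x\<in>A. d x * u i x) = 0)"
  using assms
proof (induction q arbitrary: A u)
  case 0
  then obtain x where "x \<in> A" by fastforce
  then show ?case by (intro exI[of _ "\<lambda>_. 1"]) auto
next
  case (Suc q)
  show ?case
  proof (cases "\<forall>x\<in>A. u q x = 0")
    case True
    obtain d where "\<exists>x\<in>A. d x \<noteq> 0" "\<forall>i<q. (\<Sum>x\<in>A. d x * u i x) = 0"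
      using Suc.IH[of A u] Suc.prems by auto
    then show ?thesis using True by (intro exI[of _ d]) (auto simp: less_Suc_eq)
  next
    case False
    then obtain z where z: "z \<in> A" "u q z \<noteq> 0" by blast
    let ?A = "A - {z}"
    \<comment> \<open>Subtracting multiples of row \<open>q\<close> clears the column \<open>z\<close> from the other rows; \<open>d z\<close> then solves row \<open>q\<close>.\<close>
    let ?u = "\<lambda>i x. u i x - u i z * u q x / u q z"
    have "q < card ?A" using Suc.prems z by simp
    then have "\<exists>d. (\<exists>x\<in>?A. d x \<noteq> 0) \<and> (\<forall>i<q. (\<Sum>x\<in>?A. d x * ?u i x) = 0)"
      using Suc.prems(1) by (intro Suc.IH) auto
    then obtain d where d: "\<exists>x\<in>?A. d x \<noteq> 0" "\<forall>i<q. (\<Sum>x\<in>?A. d x * ?u i x) = 0"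
      by (elim exE conjE)
    let ?s = "(\<Sum>x\<in>?A. d x * u q x) / u q z"
    let ?d = "d(z := - ?s)"
    have split: "(\<Sum>x\<in>A. ?d x * u i x) = (\<Sum>x\<in>?A. d x * u i x) - ?s * u i z" for i
    proof -
      have "(\<Sum>x\<in>A. ?d x * u i x) = ?d z * u i z + (\<Sum>x\<in>?A. ?d x * u i x)"
        by (rule sum.remove) (use Suc.prems z in auto)
      also have "(\<Sum>x\<in>?A. ?d x * u i x) = (\<Sum>x\<in>?A. d x * u i x)"
        by (rule sum.cong) auto
      finally show ?thesis by simp
    qed
    have "(\<Sum>x\<in>?A. d x * ?u i x) = (\<Sum>x\<in>?A. d x * u i x) - ?s * u i z" for i
    proof -
      have "(\<Sum>x\<in>?A. d x * ?u i x) = (\<Sum>x\<in>?A. d x * u i x - (d x * u q x) * (u i z / u q z))"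
        by (rule sum.cong) (auto simp: field_simps)
      also have "\<dots> = (\<Sum>x\<in>?A. d x * u i x) - (\<Sum>x\<in>?A. d x * u q x) * (u i z / u q z)"
        by (simp only: sum_subtractf sum_distrib_right)
      finally show ?thesis by simp
    qed
    then have "\<forall>i<q. (\<Sum>x\<in>A. ?d x * u i x) = 0" using d(2) split by simp
    moreover have "(\<Sum>x\<in>A. ?d x * u q x) = 0" unfolding split using z by simp
    ultimately show ?thesis using d(1) by (intro exI[of _ ?d]) (auto simp: less_Suc_eq)
  qed
qed

text \<open>
  Caratheodory's theorem for the boundary of a convex hull. While the support has more than \<open>q\<close> points, the
  \<open>q\<close> weighted sums are unchanged along some direction \<open>d\<close>, which can be oriented so that the total mass
  does not decrease. As all \<open>u i x\<close> are positive, \<open>d\<close> has a negative entry, so moving along it makes a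
  coordinate vanish. Keeping only \<open>q\<close> equations, and letting the mass grow, saves one support point
  against the usual \<open>q + 1\<close>.
\<close>

lemma small_support:
  fixes u :: "nat \<Rightarrow> 'a \<Rightarrow> real" and p :: "'a \<Rightarrow> real"
  assumes "finite A" "1 \<le> q" "\<And>i x. i < q \<Longrightarrow> x \<in> A \<Longrightarrow> 0 < u i x" "\<And>x. x \<in> A \<Longrightarrow> 0 \<le> p x"
  shows "\<exists>B p'. B \<subseteq> A \<and> card B \<le> q \<and> (\<forall>x\<in>B. 0 \<le> p' x) \<and> sum p A \<le> sum p' B
     \<and> (\<forall>i<q. (\<Sum>x\<in>B. p' x * u i x) = (\<Sum>x\<in>A. p x * u i x))"
  using assms
proof (induction "card A" arbitrary: A p rule: less_induct)
  case less
  show ?case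
  proof (cases "card A \<le> q")
    case True
    then show ?thesis using less.prems by (intro exI[of _ A] exI[of _ p]) auto
  next
    case False
    then obtain d0 where d0: "\<exists>x\<in>A. d0 x \<noteq> 0" "\<forall>i<q. (\<Sum>x\<in>A. d0 x * u i x) = 0"
      using linear_dependence[of A q u] less.prems(1) by auto
    define d where "d x = (if 0 \<le> sum d0 A then d0 x else - d0 x)" for x
    have d: "\<exists>x\<in>A. d x \<noteq> 0" "\<forall>i<q. (\<Sum>x\<in>A. d x * u i x) = 0" "0 \<le> sum d A"
    proof -
      have "d = d0 \<and> 0 \<le> sum d0 A \<or> d = (\<lambda>x. - d0 x) \<and> sum d0 A < 0"
        by (auto simp: d_def fun_eq_iff)
      then show "\<exists>x\<in>A. d x \<noteq> 0" "\<forall>i<q. (\<Sum>x\<in>A. d x * u i x) = 0" "0 \<le> sum d A"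
        using d0 by (elim disjE; simp add: sum_negf)+
    qed
    have "\<exists>x\<in>A. d x < 0"
    proof (rule ccontr)
      assume "\<not> ?thesis"
      then have nn: "\<forall>x\<in>A. 0 \<le> d x" by force
      have u0: "0 < u 0 x" if "x \<in> A" for x using less.prems(2,3) that by auto
      have "(\<Sum>x\<in>A. d x * u 0 x) = 0" using d(2) \<open>1 \<le> q\<close> by auto
      then have "\<forall>x\<in>A. d x * u 0 x = 0"
        using nn u0 less.prems(1) by (subst (asm) sum_nonneg_eq_0_iff) (auto simp: less_imp_le)
      then have "\<forall>x\<in>A. d x = 0" using u0 by force
      then show False using d(1) by blast
    qed
    let ?N = "{x\<in>A. d x < 0}"
    have N: "finite ?N" "?N \<noteq> {}" using \<open>\<exists>x\<in>A. d x < 0\<close> less.prems(1) by auto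
    \<comment> \<open>The coordinate that vanishes first.\<close>
    define z where "z = arg_min_on (\<lambda>x. p x / (- d x)) ?N"
    have z: "z \<in> ?N" "\<And>x. x \<in> ?N \<Longrightarrow> p z / (- d z) \<le> p x / (- d x)"
      unfolding z_def by (rule arg_min_if_finite(1)[OF N], rule arg_min_least[OF N])
    define t where "t = p z / (- d z)"
    have t0: "0 \<le> t" using z less.prems(4) unfolding t_def by (intro divide_nonneg_pos) auto
    let ?p = "\<lambda>x. p x + t * d x"
    have pz: "?p z = 0" using z(1) by (simp add: t_def)
    have pnn: "0 \<le> ?p x" if "x \<in> A" for x
    proof (cases "d x < 0")
      case True
      then have "t \<le> p x / (- d x)" using z(2) that by (simp add: t_def)
      then show ?thesis using True pos_le_divide_eq[of "- d x" t "p x"] by simp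
    next
      case False
      then show ?thesis using t0 less.prems(4)[OF that] by auto
    qed
    have zA: "z \<in> A" using z by auto
    have rem: "sum (\<lambda>x. ?p x * f x) (A - {z}) = sum (\<lambda>x. ?p x * f x) A" for f :: "'a \<Rightarrow> real"
      using sum.remove[OF less.prems(1) zA, of "\<lambda>x. ?p x * f x"] pz by simp
    have lt: "card (A - {z}) < card A" using zA less.prems(1) by (meson card_Diff1_less)
    have "\<exists>B p'. B \<subseteq> A - {z} \<and> card B \<le> q \<and> (\<forall>x\<in>B. 0 \<le> p' x) \<and> sum ?p (A - {z}) \<le> sum p' B
     \<and> (\<forall>i<q. (\<Sum>x\<in>B. p' x * u i x) = (\<Sum>x\<in>A - {z}. ?p x * u i x))"
      by (rule less.hyps[OF lt]) (use less.prems pnn in auto)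
    then obtain B p' where B: "B \<subseteq> A - {z}" "card B \<le> q" "\<forall>x\<in>B. 0 \<le> p' x" "sum ?p (A - {z}) \<le> sum p' B"
       "\<forall>i<q. (\<Sum>x\<in>B. p' x * u i x) = (\<Sum>x\<in>A - {z}. ?p x * u i x)" by blast
    have "sum ?p (A - {z}) = sum p A + t * sum d A"
      using rem[of "\<lambda>_. 1"] by (simp add: sum.distrib sum_distrib_left)
    then have "sum p A \<le> sum p' B" using B(4) t0 d(3) by (smt (verit) mult_nonneg_nonneg)
    moreover have "(\<Sum>x\<in>A - {z}. ?p x * u i x) = (\<Sum>x\<in>A. p x * u i x)" if "i < q" for i
    proof -
      have "(\<Sum>x\<in>A - {z}. ?p x * u i x) = (\<Sum>x\<in>A. p x * u i x + t * (d x * u i x))"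
        unfolding rem by (rule sum.cong) (auto simp: algebra_simps)
      also have "\<dots> = (\<Sum>x\<in>A. p x * u i x) + t * (\<Sum>x\<in>A. d x * u i x)"
        by (simp only: sum.distrib sum_distrib_left)
      finally show ?thesis using d(2) that by simp
    qed
    ultimately show ?thesis using B by (intro exI[of _ B] exI[of _ p']) auto
  qed
qed

text \<open>
  Listing each \<open>x\<close> at most \<open>k x\<close> times turns integer multiplicities into a sequence of points.
\<close>

lemma choose_with_multiplicity:
  fixes k :: "'a \<Rightarrow> nat"
  assumes "finite B" "r \<le> sum k B"
  shows "\<exists>f::nat \<Rightarrow> 'a. (\<forall>j<r. f j \<in> B) \<and>
    (\<forall>u :: 'a \<Rightarrow> real. (\<forall>x\<in>B. 0 \<le> u x) \<longrightarrow> (\<Sum>j<r. u (f j)) \<le> (\<Sum>x\<in>B. real (k x) * u x))"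
  using assms
proof (induction r arbitrary: k)
  case 0
  then show ?case by (auto intro!: sum_nonneg)
next
  case (Suc r)
  then obtain z where z: "z \<in> B" "0 < k z"
    by (metis Suc_le_lessD gr_zeroI not_less_zero sum.neutral)
  let ?k = "k(z := k z - 1)"
  have s: "(\<Sum>x\<in>B. real (k x) * u x) = (\<Sum>x\<in>B. real (?k x) * u x) + u z" for u :: "'a \<Rightarrow> real"
  proof -
    have "(\<Sum>x\<in>B. real (k x) * u x) = (\<Sum>x\<in>B. real (?k x) * u x + (if x = z then u z else 0))"
      using z by (intro sum.cong) (auto simp: of_nat_diff algebra_simps)
    also have "\<dots> = (\<Sum>x\<in>B. real (?k x) * u x) + (\<Sum>x\<in>B. if x = z then u z else 0)"
      by (rule sum.distrib)
    also have "(\<Sum>x\<in>B. if x = z then u z else 0) = u z" using z Suc.prems(1) by (simp add: sum.delta)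
    finally show ?thesis .
  qed
  have "real (sum k B) = real (sum ?k B) + 1" using s[of "\<lambda>_. 1"] by simp
  then have "r \<le> sum ?k B" using Suc.prems by linarith
  then obtain f where f: "\<forall>j<r. f j \<in> B"
    "\<And>u :: 'a \<Rightarrow> real. (\<forall>x\<in>B. 0 \<le> u x) \<Longrightarrow> (\<Sum>j<r. u (f j)) \<le> (\<Sum>x\<in>B. real (?k x) * u x)"
    using Suc.IH[of ?k] Suc.prems by blast
  have "(\<Sum>j<Suc r. u ((f(r := z)) j)) \<le> (\<Sum>x\<in>B. real (k x) * u x)" if "\<forall>x\<in>B. 0 \<le> u x" for u :: "'a \<Rightarrow> real"
  proof -
    have "(\<Sum>j<r. u ((f(r := z)) j)) = (\<Sum>j<r. u (f j))" by (rule sum.cong) auto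
    then show ?thesis using f(2)[OF that] s[of u] by simp
  qed
  then show ?case using f(1) z by (intro exI[of _ "f(r := z)"]) (auto simp: less_Suc_eq)
qed

text \<open>
  The source of the constant \<open>r + q - 1\<close>. Reduce \<open>p\<close> to at most \<open>q\<close> points, scale it to total mass
  \<open>r + q - 1\<close> and round each weight down: every point loses less than \<open>1\<close>, so the integer weights add
  up to more than \<open>r - 1\<close>, that is, to at least \<open>r\<close>. Hence \<open>r\<close> points, possibly with repetitions, have in each of
  the \<open>q\<close> coordinates a sum of at most \<open>r + q - 1\<close> times the average.
\<close>

lemma light_selection:
  fixes u :: "nat \<Rightarrow> 'a \<Rightarrow> real" and p :: "'a \<Rightarrow> real"
  assumes "finite A" "1 \<le> q" and u: "\<And>i x. i < q \<Longrightarrow> x \<in> A \<Longrightarrow> 0 < u i x"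
    and p: "\<And>x. x \<in> A \<Longrightarrow> 0 \<le> p x" and pos: "0 < sum p A"
  shows "\<exists>f::nat \<Rightarrow> 'a. (\<forall>j<r. f j \<in> A) \<and>
    (\<forall>i<q. sum p A * (\<Sum>j<r. u i (f j)) \<le> (real r + real q - 1) * (\<Sum>x\<in>A. p x * u i x))"
proof -
  obtain B p' where B: "B \<subseteq> A" "card B \<le> q" "\<forall>x\<in>B. 0 \<le> p' x" "sum p A \<le> sum p' B"
     "\<forall>i<q. (\<Sum>x\<in>B. p' x * u i x) = (\<Sum>x\<in>A. p x * u i x)"
    using small_support[of A q u p] assms by auto
  have finB: "finite B" using B(1) assms(1) finite_subset by blast
  let ?s = "real r + real q - 1"
  let ?P = "sum p' B"
  have P: "0 < ?P" using B(4) pos by linarith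
  have Bne: "B \<noteq> {}" using P by auto
  have s0: "0 \<le> ?s" using \<open>1 \<le> q\<close> by linarith
  define k where "k x = nat \<lfloor>?s * p' x / ?P\<rfloor>" for x
  have k_ge: "?s * p' x / ?P - 1 < real (k x)" for x unfolding k_def by linarith
  have k_le: "real (k x) \<le> ?s * p' x / ?P" if "x \<in> B" for x
  proof -
    have "0 \<le> ?s * p' x / ?P" using s0 P B(3) that by auto
    then show ?thesis unfolding k_def by linarith
  qed
  have "(\<Sum>x\<in>B. ?s * p' x / ?P - 1) < (\<Sum>x\<in>B. real (k x))"
    by (rule sum_strict_mono) (use finB Bne k_ge in auto)
  moreover have "(\<Sum>x\<in>B. ?s * p' x / ?P - 1) = ?s - real (card B)"
  proof -
    have "(\<Sum>x\<in>B. ?s * p' x / ?P) = ?s * ?P / ?P"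
      by (simp only: sum_distrib_left sum_divide_distrib)
    then show ?thesis using P by (simp add: sum_subtractf)
  qed
  ultimately have "real r - 1 < real (sum k B)" using B(2) by simp
  then have "r \<le> sum k B" by linarith
  then obtain f where f: "\<forall>j<r. f j \<in> B"
    "\<And>u :: 'a \<Rightarrow> real. (\<forall>x\<in>B. 0 \<le> u x) \<Longrightarrow> (\<Sum>j<r. u (f j)) \<le> (\<Sum>x\<in>B. real (k x) * u x)"
    using choose_with_multiplicity[OF finB] by blast
  have "sum p A * (\<Sum>j<r. u i (f j)) \<le> ?s * (\<Sum>x\<in>A. p x * u i x)" if i: "i < q" for i
  proof -
    have u0: "0 \<le> u i x" if "x \<in> B" for x using u i that B(1) by (meson less_imp_le subsetD)
    have n0: "0 \<le> (\<Sum>j<r. u i (f j))" by (intro sum_nonneg) (use f(1) u0 in auto)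
    have "(\<Sum>j<r. u i (f j)) \<le> (\<Sum>x\<in>B. real (k x) * u i x)" using f(2) u0 by auto
    also have "\<dots> \<le> (\<Sum>x\<in>B. ?s * p' x / ?P * u i x)"
      by (intro sum_mono mult_right_mono k_le u0)
    also have "\<dots> = ?s / ?P * (\<Sum>x\<in>B. p' x * u i x)"
      unfolding sum_distrib_left by (rule sum.cong) (auto simp: mult_ac)
    finally have "?P * (\<Sum>j<r. u i (f j)) \<le> ?s * (\<Sum>x\<in>B. p' x * u i x)"
      using P by (simp add: field_simps)
    moreover have "sum p A * (\<Sum>j<r. u i (f j)) \<le> ?P * (\<Sum>j<r. u i (f j))"
      using B(4) n0 by (rule mult_right_mono)
    ultimately show ?thesis using B(5) i by simp
  qed
  then show ?thesis using f(1) B(1) by (intro exI[of _ f]) auto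
qed

text \<open>
  The previous selection applied to the vertices, where \<open>v\<close> carries the \<open>q\<close> weights \<open>b ^ N i v\<close>.
  Vertices with some \<open>N i v \<ge> K\<close> are discarded, so only \<open>K ^ q\<close> weight vectors (types) remain; types with
  fewer than \<open>r * m\<close> vertices are discarded too. Every other type can supply up to \<open>r\<close> disjoint sets of
  \<open>m\<close> vertices, which allows for the repetitions in the selection.
\<close>

lemma light_classes:
  fixes N :: "nat \<Rightarrow> 'v \<Rightarrow> nat" and b \<theta> :: real
  assumes "finite V" "card V = n" "0 < n" "1 \<le> q" "0 < b" "\<theta> < 1"
    and few: "real (card {v \<in> V. \<exists>i<q. K \<le> N i v}) + real (K ^ q * (r * m)) \<le> \<theta> * real n"
  shows "\<exists>A t. disjoint_family_on A {..<r} \<and>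
    (\<forall>j<r. A j \<subseteq> V \<and> card (A j) = m \<and> (\<forall>i<q. t j i < K \<and> (\<forall>v\<in>A j. N i v = t j i))) \<and>
    (\<forall>i<q. (1 - \<theta>) * real n * (\<Sum>j<r. b ^ t j i) \<le> (real r + real q - 1) * (\<Sum>v\<in>V. b ^ N i v))"
proof -
  define S where "S = {v \<in> V. \<exists>i<q. K \<le> N i v}"
  define U where "U = {v \<in> V. \<forall>i<q. N i v < K}"
  define ty where "ty v = (\<lambda>i\<in>{..<q}. N i v)" for v
  let ?T = "PiE {..<q} (\<lambda>_. {..<K})"
  define cls where "cls t = {v \<in> U. ty v = t}" for t
  define B where "B = {t \<in> ?T. r * m \<le> card (cls t)}"
  have finT: "finite ?T" by (intro finite_PiE) auto
  have cT: "card ?T = K ^ q" by (simp add: card_PiE)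
  have finU: "finite U" using assms(1) by (auto simp: U_def)
  have fincls: "finite (cls t)" for t using finU by (auto simp: cls_def)
  have ran: "ty ` U \<subseteq> ?T" by (simp add: image_subset_iff ty_def U_def restrict_PiE_iff)
  have BT: "B \<subseteq> ?T" by (auto simp: B_def)
  have finB: "finite B" using BT finT finite_subset by blast
  have group: "(\<Sum>t\<in>?T. sum g (cls t)) = sum g U" for g :: "'v \<Rightarrow> real"
    unfolding cls_def using sum.group[OF finU finT ran, of g] by simp
  have "V = S \<union> U" by (auto simp: S_def U_def not_less)
  then have "n \<le> card S + card U" using assms(2) card_Un_le[of S U] by simp
  moreover have "real (card U) = (\<Sum>t\<in>?T. real (card (cls t)))"
    using group[of "\<lambda>_. 1"] by simp
  moreover have "(\<Sum>t\<in>?T. real (card (cls t))) = (\<Sum>t\<in>B. real (card (cls t))) + (\<Sum>t\<in>?T - B. real (card (cls t)))"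
    using sum.subset_diff[OF BT finT] by (simp add: add.commute)
  moreover have "(\<Sum>t\<in>?T - B. real (card (cls t))) \<le> (\<Sum>t\<in>?T - B. real (r * m))"
  proof (rule sum_mono)
    fix t assume "t \<in> ?T - B"
    then have "\<not> r * m \<le> card (cls t)" by (simp add: B_def)
    then have "card (cls t) \<le> r * m" by linarith
    then show "real (card (cls t)) \<le> real (r * m)" by (simp only: of_nat_le_iff)
  qed
  moreover have "(\<Sum>t\<in>?T - B. real (r * m)) \<le> real (K ^ q * (r * m))"
  proof -
    have "card (?T - B) \<le> K ^ q" using card_mono[OF finT, of "?T - B"] cT by auto
    then have "card (?T - B) * (r * m) \<le> K ^ q * (r * m)" by (rule mult_le_mono1)
    then show ?thesis unfolding sum_constant of_nat_mult[symmetric] of_nat_le_iff .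
  qed
  ultimately have big: "(1 - \<theta>) * real n \<le> (\<Sum>t\<in>B. real (card (cls t)))"
    using few by (simp add: S_def[symmetric] algebra_simps)
  moreover have "0 < (1 - \<theta>) * real n" using assms by simp
  ultimately have pos: "0 < (\<Sum>t\<in>B. real (card (cls t)))" by linarith
  obtain f where f: "\<And>j. j < r \<Longrightarrow> f j \<in> B"
    "\<And>i. i < q \<Longrightarrow> (\<Sum>t\<in>B. real (card (cls t))) * (\<Sum>j<r. b ^ f j i)
       \<le> (real r + real q - 1) * (\<Sum>t\<in>B. real (card (cls t)) * b ^ t i)"
    using light_selection[of B q "\<lambda>i t. b ^ t i" "\<lambda>t. real (card (cls t))" r] finB assms(4,5) pos
    by auto
  have "\<exists>Q. disjoint_family_on Q {..<r} \<and> (\<forall>x\<in>{..<r}. Q x \<subseteq> cls t \<and> card (Q x) = m)" if "t \<in> B" for t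
    by (rule disjoint_subsets_of_card) (use that fincls in \<open>auto simp: B_def\<close>)
  then obtain Q where Q: "\<And>t. t \<in> B \<Longrightarrow> disjoint_family_on (Q t) {..<r}"
    "\<And>t x. t \<in> B \<Longrightarrow> x < r \<Longrightarrow> Q t x \<subseteq> cls t \<and> card (Q t x) = m"
    by (metis lessThan_iff)
  let ?A = "\<lambda>j. Q (f j) j"
  have Acls: "?A j \<subseteq> cls (f j)" "card (?A j) = m" if "j < r" for j
    using Q(2)[OF f(1)] that by auto
  have "disjoint_family_on ?A {..<r}"
    unfolding disjoint_family_on_def
  proof (intro ballI impI equals0I)
    fix j j' v assume *: "j \<in> {..<r}" "j' \<in> {..<r}" "j \<noteq> j'" "v \<in> ?A j \<inter> ?A j'"
    then have "v \<in> cls (f j)" "v \<in> cls (f j')" using Acls by auto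
    then have "f j = f j'" by (simp add: cls_def)
    then show False using * Q(1)[OF f(1), of j] by (auto simp: disjoint_family_on_def)
  qed
  moreover have "?A j \<subseteq> V \<and> card (?A j) = m \<and> (\<forall>i<q. f j i < K \<and> (\<forall>v\<in>?A j. N i v = f j i))" if j: "j < r" for j
  proof -
    have "f j \<in> ?T" using f(1)[OF j] BT by blast
    moreover have "N i v = f j i" if "v \<in> ?A j" "i < q" for v i
    proof -
      have "ty v = f j" using Acls(1)[OF j] that by (auto simp: cls_def)
      then show ?thesis using that by (auto simp: ty_def fun_eq_iff restrict_def split: if_splits)
    qed
    ultimately show ?thesis using Acls[OF j] by (auto simp: cls_def U_def)
  qed
  moreover have "(1 - \<theta>) * real n * (\<Sum>j<r. b ^ f j i) \<le> (real r + real q - 1) * (\<Sum>v\<in>V. b ^ N i v)" if i: "i < q" for i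
  proof -
    have "(1 - \<theta>) * real n * (\<Sum>j<r. b ^ f j i) \<le> (\<Sum>t\<in>B. real (card (cls t))) * (\<Sum>j<r. b ^ f j i)"
      by (intro mult_right_mono big sum_nonneg) (use \<open>0 < b\<close> in auto)
    also have "\<dots> \<le> (real r + real q - 1) * (\<Sum>t\<in>B. real (card (cls t)) * b ^ t i)" by (rule f(2)[OF i])
    also have "\<dots> \<le> (real r + real q - 1) * (\<Sum>v\<in>V. b ^ N i v)"
    proof (rule mult_left_mono)
      have "(\<Sum>t\<in>B. real (card (cls t)) * b ^ t i) = (\<Sum>t\<in>B. \<Sum>v\<in>cls t. b ^ N i v)"
      proof (rule sum.cong[OF refl])
        fix t assume "t \<in> B"
        have "(\<Sum>v\<in>cls t. b ^ N i v) = (\<Sum>v\<in>cls t. b ^ t i)"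
          by (rule sum.cong) (use i in \<open>auto simp: cls_def ty_def\<close>)
        then show "real (card (cls t)) * b ^ t i = (\<Sum>v\<in>cls t. b ^ N i v)" by simp
      qed
      also have "\<dots> \<le> (\<Sum>t\<in>?T. \<Sum>v\<in>cls t. b ^ N i v)"
        by (rule sum_mono2[OF finT BT], rule sum_nonneg) (simp add: \<open>0 < b\<close> less_imp_le)
      also have "\<dots> = (\<Sum>v\<in>U. b ^ N i v)" by (rule group)
      also have "\<dots> \<le> (\<Sum>v\<in>V. b ^ N i v)"
        by (rule sum_mono2[OF assms(1)]) (use \<open>0 < b\<close> in \<open>auto simp: U_def\<close>)
      finally show "(\<Sum>t\<in>B. real (card (cls t)) * b ^ t i) \<le> (\<Sum>v\<in>V. b ^ N i v)" .
    qed (use assms(4) in linarith)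
    finally show ?thesis .
  qed
  ultimately show ?thesis by (intro exI[of _ ?A] exI[of _ f]) blast
qed

section \<open>A dense colour\<close>

lemma inj_on_transversal_image:
  assumes "disjoint_family_on A {..<r}"
  shows "inj_on (\<lambda>a. a ` {..<r}) (PiE {..<r} A)" "a \<in> PiE {..<r} A \<Longrightarrow> card (a ` {..<r}) = r"
proof -
  have idx: "i = j" if "a \<in> PiE {..<r} A" "b \<in> PiE {..<r} A" "i < r" "j < r" "a i = b j" for a b i j
  proof (rule ccontr)
    assume "i \<noteq> j"
    then have "A i \<inter> A j = {}" using assms that(3,4) by (auto simp: disjoint_family_on_def)
    moreover have "a i \<in> A i" "b j \<in> A j" using PiE_mem[OF that(1)] PiE_mem[OF that(2)] that(3,4) by auto
    ultimately show False using that(5) by auto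
  qed
  show "inj_on (\<lambda>a. a ` {..<r}) (PiE {..<r} A)"
  proof (rule inj_onI)
    fix a b assume ab: "a \<in> PiE {..<r} A" "b \<in> PiE {..<r} A" "a ` {..<r} = b ` {..<r}"
    show "a = b"
    proof (rule PiE_ext[OF ab(1,2)])
      fix j assume j: "j \<in> {..<r}"
      then obtain i where "i < r" "a j = b i" using ab(3) by (metis (no_types) imageE imageI lessThan_iff)
      then show "a j = b j" using idx[OF ab(1,2), of j i] j by auto
    qed
  qed
  show "card (a ` {..<r}) = r" if "a \<in> PiE {..<r} A"
  proof -
    have "inj_on a {..<r}" using idx[OF that that] by (auto intro: inj_onI)
    then show ?thesis by (simp add: card_image)
  qed
qed

text \<open>
  At most \<open>\<epsilon> * n ^ r\<close> of the \<open>M ^ r\<close> transversal sets are missing from the hypergraph. When this is at most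
  half of them, the most frequent colour has density at least \<open>1 / (2 * q)\<close>.
\<close>

lemma dense_colour:
  fixes \<epsilon> :: real
  assumes "r_graph r V E" "card V = n" "edge_colouring q E c" "1 \<le> q" "0 \<le> \<epsilon>"
    and dense: "(1 - \<epsilon>) * real (n choose r) \<le> real (card E)"
    and A: "disjoint_family_on A {..<r}" "\<And>j. j < r \<Longrightarrow> A j \<subseteq> V \<and> card (A j) = M"
    and small: "\<epsilon> * real n ^ r \<le> real M ^ r / 2"
  shows "\<exists>i<q. 1 / (2 * real q) * real M ^ r \<le> real (card (transversals r {e\<in>E. c e = i} A))"
proof -
  have finV: "finite V" and EV: "E \<subseteq> {e. e \<subseteq> V \<and> card e = r}" using assms(1) by (auto simp: r_graph_def)
  have finA: "finite (A j)" if "j < r" for j using A(2)[OF that] finV finite_subset by blast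
  have finPi: "finite (PiE {..<r} A)" by (intro finite_PiE) (use finA in auto)
  have cPi: "card (PiE {..<r} A) = M ^ r" using A(2) by (simp add: card_PiE)
  let ?R = "{e. e \<subseteq> V \<and> card e = r}"
  let ?N = "PiE {..<r} A - transversals r E A"
  have finR: "finite ?R" using finV by auto
  have cR: "card ?R = n choose r" using n_subsets[OF finV, of r] assms(2) by simp
  have "card ?N \<le> card (?R - E)"
  proof (rule card_inj_on_le)
    show "inj_on (\<lambda>a. a ` {..<r}) ?N" using inj_on_transversal_image(1)[OF A(1)] by (rule inj_on_subset) auto
    show "(\<lambda>a. a ` {..<r}) ` ?N \<subseteq> ?R - E"
    proof
      fix e assume "e \<in> (\<lambda>a. a ` {..<r}) ` ?N"
      then obtain a where a: "a \<in> PiE {..<r} A" "a \<notin> transversals r E A" and e: "e = a ` {..<r}" by blast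
      have "e \<subseteq> V" using PiE_mem[OF a(1)] A(2) e by blast
      moreover have "card e = r" unfolding e by (rule inj_on_transversal_image(2)[OF A(1) a(1)])
      moreover have "e \<notin> E" using a by (auto simp: e transversals_def)
      ultimately show "e \<in> ?R - E" by blast
    qed
  qed (use finR in auto)
  also have "card (?R - E) = (n choose r) - card E"
    using cR EV finR by (simp add: card_Diff_subset finite_subset)
  finally have "real (card ?N) \<le> real (n choose r) - real (card E)"
    using cR card_mono[OF finR EV] by linarith
  also have "\<dots> \<le> \<epsilon> * real (n choose r)" using dense by (simp add: algebra_simps)
  also have "\<dots> \<le> \<epsilon> * real n ^ r"
  proof (rule mult_left_mono[OF _ assms(5)])
    have "n choose r \<le> n ^ r"
      by (cases "r \<le> n") (simp_all add: binomial_le_pow binomial_eq_0)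
    then show "real (n choose r) \<le> real n ^ r" by (metis of_nat_le_iff of_nat_power)
  qed
  finally have "real (card ?N) \<le> real M ^ r / 2" using small by linarith
  moreover have "real (card (PiE {..<r} A)) = real (card (transversals r E A)) + real (card ?N)"
  proof -
    have "card (PiE {..<r} A) = card (transversals r E A) + card ?N"
      using card_Diff_subset[OF finite_subset[OF transversals_subset_PiE finPi] transversals_subset_PiE]
        card_mono[OF finPi transversals_subset_PiE] by (metis le_add_diff_inverse)
    then show ?thesis by simp
  qed
  ultimately have half: "real M ^ r / 2 \<le> real (card (transversals r E A))" using cPi by simp
  show ?thesis
  proof (rule ccontr)
    assume "\<not> ?thesis"
    then have lt: "real (card (transversals r {e\<in>E. c e = i} A)) < 1 / (2 * real q) * real M ^ r" if "i < q" for i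
      using that by force
    have "transversals r E A \<subseteq> (\<Union>i<q. transversals r {e\<in>E. c e = i} A)"
      using assms(3) by (auto simp: transversals_def edge_colouring_def)
    then have "card (transversals r E A) \<le> card (\<Union>i<q. transversals r {e\<in>E. c e = i} A)"
      by (intro card_mono) (auto intro: finite_transversals finA)
    also have "\<dots> \<le> (\<Sum>i<q. card (transversals r {e\<in>E. c e = i} A))" by (rule card_UN_le) auto
    finally have "real (card (transversals r E A)) \<le> (\<Sum>i<q. real (card (transversals r {e\<in>E. c e = i} A)))"
      by (simp flip: of_nat_sum)
    also have "\<dots> < (\<Sum>i<q. 1 / (2 * real q) * real M ^ r)"
      by (rule sum_strict_mono) (use assms(4) lt in \<open>auto simp: lessThan_empty_iff\<close>)
    also have "\<dots> = real M ^ r / 2" using assms(4) by simp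
    finally show False using half by simp
  qed
qed

section \<open>A monochromatic matching from tuples of bounded overlap\<close>

definition load :: "nat \<Rightarrow> (nat \<Rightarrow> 'v set) list \<Rightarrow> 'v \<Rightarrow> nat" where
  "load r Ws v = length (filter (\<lambda>W. v \<in> (\<Union>j<r. W j)) Ws)"

definition width :: "(nat \<Rightarrow> 'v set) \<Rightarrow> nat" where
  "width W = card (W 0)"

definition rich_tuple :: "nat \<Rightarrow> nat \<Rightarrow> 'v set set \<Rightarrow> 'v set \<Rightarrow> (nat \<Rightarrow> 'v set) \<Rightarrow> bool" where
  "rich_tuple r h F V W \<longleftrightarrow> disjoint_family_on W {..<r} \<and>
    (\<forall>j<r. W j \<subseteq> V \<and> card (W j) = width W) \<and> hereditary r h F (width W) W"

text \<open>
  Almost perfect matchings in all tuples, with weight \<open>1 / K\<close> on each edge, would form a fractional matching.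
  Rounding makes the parts of all tuples pairwise disjoint while keeping about the fraction \<open>1 / K\<close> of each,
  and the greedy algorithm inside what remains of a tuple of width \<open>w\<close> stops only when at most about
  \<open>w / h\<close> vertices of some part are left, so after about \<open>w / K - w / h\<close> edges. All other losses
  are bounded in terms of \<open>length Ws\<close> and \<open>r\<close>.
\<close>

lemma matching_from_rich_tuples:
  assumes "1 \<le> r" "1 \<le> h" "1 \<le> K" "finite V"
    and rich: "\<And>W. W \<in> set Ws \<Longrightarrow> rich_tuple r h F V W"
    and load: "\<And>v. load r Ws v \<le> K"
  shows "\<exists>M. M \<subseteq> F \<and> pairwise disjnt M \<and>
    real (\<Sum>W\<leftarrow>Ws. width W) * (1 / real K - 1 / real h) - real (length Ws) * (2 ^ (length Ws * r) + 2) \<le> real (card M)"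
proof -
  let ?T = "length Ws"
  let ?J = "{..<?T} \<times> {..<r}"
  let ?W = "\<lambda>(t, j). (Ws ! t) j"
  have R: "rich_tuple r h F V (Ws ! t)" if "t < ?T" for t using rich that by simp
  have finW: "finite (?W x)" if "x \<in> ?J" for x
    using that R assms(4) by (auto simp: rich_tuple_def intro: finite_subset)
  have cardJ: "card ?J = ?T * r" by simp
  \<comment> \<open>The parts of one tuple are disjoint, so a vertex meets as many parts as it meets tuples.\<close>
  have ld: "card {x \<in> ?J. v \<in> ?W x} \<le> K" for v
  proof -
    have "card {x \<in> ?J. v \<in> ?W x} \<le> card {t. t < ?T \<and> v \<in> (\<Union>j<r. (Ws ! t) j)}"
    proof (rule card_inj_on_le[of fst])
      show "inj_on fst {x \<in> ?J. v \<in> ?W x}"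
      proof (rule inj_onI, clarify)
        fix t j t' j' assume *: "t < ?T" "j < r" "j' < r" "v \<in> (Ws ! t) j" "v \<in> (Ws ! t') j'" "fst (t, j) = fst (t', j')"
        then show "t = t' \<and> j = j'"
          using R[OF *(1)] by (auto simp: rich_tuple_def disjoint_family_on_def)
      qed
    qed auto
    also have "\<dots> = load r Ws v" by (simp add: load_def length_filter_conv_card)
    finally show ?thesis using load[of v] by linarith
  qed
  obtain Y where Y: "disjoint_family_on Y ?J"
    "\<And>x. x \<in> ?J \<Longrightarrow> Y x \<subseteq> ?W x \<and> card (?W x) \<le> K * (card (Y x) + 2 ^ card ?J)"
    using split_bounded_overlap[of ?J ?W K] finW assms(3) ld by blast
  let ?w = "\<lambda>t. width (Ws ! t)"
  define good where "good t M \<longleftrightarrow> M \<subseteq> F \<and> finite M \<and> pairwise disjnt M \<and> (\<forall>e\<in>M. e \<noteq> {} \<and> e \<subseteq> (\<Union>j<r. Y (t, j)))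
      \<and> ?w t div K - 2 ^ (?T * r) \<le> card M + (?w t div h + 1)" for t M
  have "\<exists>M. good t M" if t: "t < ?T" for t
    unfolding good_def
  proof (rule greedy_matching[OF assms(1)])
    have YW: "Y (t, j) \<subseteq> (Ws ! t) j" if "j < r" for j using Y(2)[of "(t, j)"] t that by auto
    show "finite (Y (t, j))" if "j < r" for j
      using YW[OF that] finW[of "(t, j)"] t that finite_subset by auto
    show "disjoint_family_on (\<lambda>j. Y (t, j)) {..<r}"
      using Y(1) t by (auto simp: disjoint_family_on_def)
    show "?w t div K - 2 ^ (?T * r) \<le> card (Y (t, j))" if "j < r" for j
    proof -
      have "?w t \<le> K * (card (Y (t, j)) + 2 ^ (?T * r))"
        using Y(2)[of "(t, j)"] t that R[OF t] unfolding cardJ by (auto simp: rich_tuple_def)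
      then have "?w t div K \<le> K * (card (Y (t, j)) + 2 ^ (?T * r)) div K" by (rule div_le_mono)
      then show ?thesis using assms(3) by simp
    qed
    fix X assume X: "\<And>j. j < r \<Longrightarrow> X j \<subseteq> Y (t, j) \<and> ?w t div h + 1 \<le> card (X j)"
    have "X j \<subseteq> (Ws ! t) j \<and> ?w t \<le> h * card (X j)" if "j < r" for j
    proof -
      have "?w t < h * (?w t div h + 1)" using assms(2) by (simp add: dividend_less_times_div)
      also have "\<dots> \<le> h * card (X j)" using X[OF that] by (intro mult_le_mono2) auto
      finally show ?thesis using X[OF that] YW[OF that] by auto
    qed
    then show "transversals r F X \<noteq> {}" using R[OF t] by (auto simp: rich_tuple_def hereditary_def)
  qed
  then obtain M where "\<And>t. t < ?T \<Longrightarrow> good t (M t)" by metis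
  then have M: "\<And>t. t < ?T \<Longrightarrow> M t \<subseteq> F" "\<And>t. t < ?T \<Longrightarrow> finite (M t)"
    "\<And>t. t < ?T \<Longrightarrow> pairwise disjnt (M t)"
    "\<And>t e. t < ?T \<Longrightarrow> e \<in> M t \<Longrightarrow> e \<noteq> {} \<and> e \<subseteq> (\<Union>j<r. Y (t, j))"
    "\<And>t. t < ?T \<Longrightarrow> ?w t div K - 2 ^ (?T * r) \<le> card (M t) + (?w t div h + 1)"
    by (auto simp only: good_def)
  have sep: "disjnt e e'" if "t < ?T" "t' < ?T" "t \<noteq> t'" "e \<in> M t" "e' \<in> M t'" for t t' e e'
  proof -
    have "(\<Union>j<r. Y (t, j)) \<inter> (\<Union>j<r. Y (t', j)) = {}"
      using Y(1) that(1-3) by (fastforce simp: disjoint_family_on_def)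
    then show ?thesis using M(4)[OF that(1,4)] M(4)[OF that(2,5)] by (auto simp: disjnt_def)
  qed
  let ?M = "\<Union>t<?T. M t"
  have "pairwise disjnt ?M"
    unfolding pairwise_def
  proof (intro ballI impI)
    fix e e' assume "e \<in> ?M" "e' \<in> ?M" "e \<noteq> e'"
    then obtain t t' where "t < ?T" "e \<in> M t" "t' < ?T" "e' \<in> M t'" by auto
    then show "disjnt e e'" using sep M(3) \<open>e \<noteq> e'\<close> by (cases "t = t'") (auto simp: pairwise_def)
  qed
  moreover have "card ?M = (\<Sum>t<?T. card (M t))"
  proof (rule card_UN_disjoint)
    show "\<forall>t\<in>{..<?T}. \<forall>t'\<in>{..<?T}. t \<noteq> t' \<longrightarrow> M t \<inter> M t' = {}"
    proof (intro ballI impI equals0I)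
      fix t t' e assume "t \<in> {..<?T}" "t' \<in> {..<?T}" "t \<noteq> t'" "e \<in> M t \<inter> M t'"
      then show False using sep[of t t' e e] M(4)[of t e] by (auto simp: disjnt_def)
    qed
  qed (use M(2) in auto)
  moreover have "real (?w t) * (1 / real K - 1 / real h) - (2 ^ (?T * r) + 2) \<le> real (card (M t))" if t: "t < ?T" for t
  proof -
    have "?w t div K \<le> card (M t) + ?w t div h + 1 + 2 ^ (?T * r)" using M(5)[OF t] by linarith
    then have "real (?w t div K) \<le> real (card (M t) + ?w t div h + 1 + 2 ^ (?T * r))"
      by (simp only: of_nat_le_iff)
    then have "real (?w t div K) \<le> real (card (M t)) + real (?w t div h) + 1 + 2 ^ (?T * r)" by simp
    moreover have "real (?w t div h) \<le> real (?w t) / real h" by (rule of_nat_div_le_of_nat)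
    moreover have "real (?w t) / real K - 1 \<le> real (?w t div K)"
    proof -
      have "?w t \<le> K * (?w t div K + 1)"
        using dividend_less_times_div[of K "?w t"] assms(3) by simp
      then have "real (?w t) \<le> real (K * (?w t div K + 1))" by (simp only: of_nat_le_iff)
      then have "real (?w t) \<le> real K * (real (?w t div K) + 1)" by (simp add: distrib_left)
      then show ?thesis using assms(3) by (simp add: field_simps)
    qed
    ultimately show ?thesis by (simp add: right_diff_distrib)
  qed
  then have "(\<Sum>t<?T. real (?w t) * (1 / real K - 1 / real h) - (2 ^ (?T * r) + 2)) \<le> (\<Sum>t<?T. real (card (M t)))"
    by (intro sum_mono) auto
  moreover have "(\<Sum>t<?T. real (?w t) * (1 / real K - 1 / real h) - (2 ^ (?T * r) + 2)) =
     real (\<Sum>W\<leftarrow>Ws. width W) * (1 / real K - 1 / real h) - real ?T * (2 ^ (?T * r) + 2)"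
  proof -
    have "(\<Sum>W\<leftarrow>Ws. width W) = (\<Sum>t<?T. ?w t)"
      by (simp add: sum_list_sum_nth atLeast0LessThan)
    then show ?thesis by (simp add: sum_subtractf sum_distrib_right)
  qed
  ultimately show ?thesis using M(1) by (intro exI[of _ ?M]) auto
qed

section \<open>Multiplicative weights\<close>

text \<open>
  The list \<open>L i\<close> holds the tuples chosen so far in colour \<open>i\<close>. The last condition bounds the potential of
  colour \<open>i\<close> in terms of the total width of its tuples; it forces the loads in colour \<open>i\<close> to be spread
  evenly, because a few heavily loaded vertices would make the potential exponentially large.
\<close>

definition admissible ::
  "nat \<Rightarrow> nat \<Rightarrow> nat \<Rightarrow> nat \<Rightarrow> nat \<Rightarrow> real \<Rightarrow> real \<Rightarrow> 'v set \<Rightarrow> 'v set set \<Rightarrow> ('v set \<Rightarrow> nat)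
    \<Rightarrow> (nat \<Rightarrow> (nat \<Rightarrow> 'v set) list) \<Rightarrow> bool" where
  "admissible r q h K m b \<alpha> V E c L \<longleftrightarrow> (\<forall>i<q.
     (\<forall>W\<in>set (L i). rich_tuple r h {e\<in>E. c e = i} V W \<and> m \<le> width W) \<and>
     (\<forall>v. load r (L i) v \<le> K) \<and>
     (\<Sum>v\<in>V. b ^ load r (L i) v) \<le> real (card V) * exp (\<alpha> * real (\<Sum>W\<leftarrow>L i. width W)))"

text \<open>
  One round. By the bound on the potentials, few vertices have reached load \<open>K\<close> in some colour. Among the
  others there are \<open>r\<close> classes of equally loaded vertices whose weights \<open>b ^ t j i\<close> sum to at most
  \<open>(r + q - 1) / (1 - \<theta>)\<close> times the average weight, simultaneously for all colours \<open>i\<close>. Whichever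
  colour turns out to be dense between these classes, adding a tuple of width \<open>w\<close> there multiplies its
  potential by at most \<open>1 + \<alpha> * w\<close>, which the factor \<open>exp (\<alpha> * w)\<close> in the invariant absorbs.
\<close>

lemma extend_admissible:
  fixes b \<alpha> \<epsilon> \<theta> \<tau> :: real
  assumes G: "r_graph r V E" "card V = n" "edge_colouring q E c"
    and dense: "(1 - \<epsilon>) * real (n choose r) \<le> real (card E)" "0 \<le> \<epsilon>"
      "\<epsilon> * real n ^ r \<le> real (m * h ^ P) ^ r / 2"
    and par: "1 \<le> r" "1 \<le> q" "2 \<le> h" "1 \<le> m" "0 < n" "1 < b" "\<theta> < 1"
    and P: "1 < 1 / (2 * real q) * (real h ^ r / (real h ^ r - 1)) ^ P"
    and few: "real q * exp (\<alpha> * \<tau>) / b ^ K * real n + real (K ^ q * (r * (m * h ^ P))) \<le> \<theta> * real n"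
    and \<alpha>: "(b - 1) * (real r + real q - 1) \<le> \<alpha> * ((1 - \<theta>) * real n)" "0 \<le> \<alpha>"
    and L: "admissible r q h K m b \<alpha> V E c L"
    and size: "\<And>i. i < q \<Longrightarrow> real (\<Sum>W\<leftarrow>L i. width W) \<le> \<tau>"
  shows "\<exists>i<q. \<exists>W. admissible r q h K m b \<alpha> V E c (L(i := W # L i))"
proof -
  have finV: "finite V" using G(1) by (simp add: r_graph_def)
  let ?N = "\<lambda>i. load r (L i)"
  let ?\<Phi> = "\<lambda>i. \<Sum>v\<in>V. b ^ ?N i v"
  have Li: "?\<Phi> i \<le> real n * exp (\<alpha> * real (\<Sum>W\<leftarrow>L i. width W))" "\<And>v. ?N i v \<le> K"
    "\<And>W. W \<in> set (L i) \<Longrightarrow> rich_tuple r h {e\<in>E. c e = i} V W \<and> m \<le> width W" if "i < q" for i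
    using L that G(2) by (auto simp: admissible_def)
  \<comment> \<open>Markov's inequality for the potential.\<close>
  have sat: "real (card {v \<in> V. K \<le> ?N i v}) \<le> exp (\<alpha> * \<tau>) / b ^ K * real n" if i: "i < q" for i
  proof -
    have "real (card {v \<in> V. K \<le> ?N i v}) * b ^ K = (\<Sum>v\<in>{v \<in> V. K \<le> ?N i v}. b ^ K)" by simp
    also have "\<dots> \<le> (\<Sum>v\<in>{v \<in> V. K \<le> ?N i v}. b ^ ?N i v)"
      using par(6) by (intro sum_mono power_increasing) auto
    also have "\<dots> \<le> ?\<Phi> i" using par(6) finV by (intro sum_mono2) auto
    also have "\<dots> \<le> real n * exp (\<alpha> * real (\<Sum>W\<leftarrow>L i. width W))" by (rule Li(1)[OF i])
    also have "\<dots> \<le> real n * exp (\<alpha> * \<tau>)"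
      using \<alpha>(2) size[OF i] by (intro mult_left_mono) (auto intro: mult_left_mono)
    finally show ?thesis using par(6) by (simp add: field_simps)
  qed
  have "{v \<in> V. \<exists>i<q. K \<le> ?N i v} = (\<Union>i<q. {v \<in> V. K \<le> ?N i v})" by auto
  then have "card {v \<in> V. \<exists>i<q. K \<le> ?N i v} \<le> (\<Sum>i<q. card {v \<in> V. K \<le> ?N i v})"
    by (simp add: card_UN_le)
  then have "real (card {v \<in> V. \<exists>i<q. K \<le> ?N i v}) \<le> (\<Sum>i<q. real (card {v \<in> V. K \<le> ?N i v}))"
    by (simp flip: of_nat_sum)
  also have "\<dots> \<le> (\<Sum>i<q. exp (\<alpha> * \<tau>) / b ^ K * real n)" by (intro sum_mono sat) auto
  also have "\<dots> = real q * exp (\<alpha> * \<tau>) / b ^ K * real n" by simp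
  finally have unsat: "real (card {v \<in> V. \<exists>i<q. K \<le> ?N i v}) + real (K ^ q * (r * (m * h ^ P))) \<le> \<theta> * real n"
    using few by linarith
  have "0 < b" using par(6) by linarith
  obtain A t where A: "disjoint_family_on A {..<r}" "\<And>j. j < r \<Longrightarrow> A j \<subseteq> V \<and> card (A j) = m * h ^ P"
    and t: "\<And>i j v. j < r \<Longrightarrow> i < q \<Longrightarrow> v \<in> A j \<Longrightarrow> ?N i v = t j i" "\<And>i j. j < r \<Longrightarrow> i < q \<Longrightarrow> t j i < K"
    and light: "\<And>i. i < q \<Longrightarrow> (1 - \<theta>) * real n * (\<Sum>j<r. b ^ t j i) \<le> (real r + real q - 1) * ?\<Phi> i"
    using light_classes[where N = ?N, OF finV G(2) par(5,2) \<open>0 < b\<close> par(7) unsat] by blast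
  obtain i where i: "i < q" "1 / (2 * real q) * real (m * h ^ P) ^ r \<le> real (card (transversals r {e\<in>E. c e = i} A))"
    using dense_colour[OF G par(2) dense(2,1) A dense(3)] by blast
  have "finite (A j)" if "j < r" for j using A(2)[OF that] finV finite_subset by blast
  then obtain p W where W: "\<And>j. j < r \<Longrightarrow> W j \<subseteq> A j \<and> card (W j) = m * h ^ p"
     "hereditary r h {e\<in>E. c e = i} (m * h ^ p) W"
    using hereditary_subtuple[OF par(1,3,4) _ _ i(2) P] A(2) by blast
  have w: "width W = m * h ^ p" using W(1)[of 0] par(1) by (simp add: width_def)
  have Wdisj: "disjoint_family_on W {..<r}"
    unfolding disjoint_family_on_def
  proof (intro ballI impI)
    fix j j' assume j: "j \<in> {..<r}" "j' \<in> {..<r}" "j \<noteq> j'"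
    then have "A j \<inter> A j' = {}" using A(1) by (simp add: disjoint_family_on_def)
    then show "W j \<inter> W j' = {}" using W(1)[of j] W(1)[of j'] j by blast
  qed
  have rich: "rich_tuple r h {e\<in>E. c e = i} V W"
    using Wdisj W A(2) unfolding rich_tuple_def w by blast
  have mw: "m \<le> width W" using par(3) by (simp add: w)
  let ?U = "\<Union>j<r. W j"
  let ?L = "L(i := W # L i)"
  have UV: "?U \<subseteq> V" using W(1) A(2) by blast
  have ld: "load r (W # L i) v = ?N i v + (if v \<in> ?U then 1 else 0)" for v
    by (auto simp: load_def)
  have "load r (W # L i) v \<le> K" for v
  proof (cases "v \<in> ?U")
    case True
    then obtain j where "j < r" "v \<in> A j" using W(1) by blast
    then have "?N i v < K" using t(1)[of j i v] t(2)[of j i] i(1) by simp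
    then show ?thesis by (simp add: ld)
  qed (use Li(2)[OF i(1)] in \<open>auto simp: ld\<close>)
  moreover have "(\<Sum>v\<in>V. b ^ load r (W # L i) v) \<le> real n * exp (\<alpha> * real (\<Sum>W\<leftarrow>W # L i. width W))"
  proof -
    have "(\<Sum>v\<in>V. b ^ load r (W # L i) v) = (\<Sum>v\<in>V. b ^ ?N i v + (if v \<in> ?U then (b - 1) * b ^ ?N i v else 0))"
      by (rule sum.cong) (auto simp: ld algebra_simps)
    also have "\<dots> = ?\<Phi> i + (\<Sum>v\<in>V. if v \<in> ?U then (b - 1) * b ^ ?N i v else 0)" by (rule sum.distrib)
    also have "(\<Sum>v\<in>V. if v \<in> ?U then (b - 1) * b ^ ?N i v else 0) = (\<Sum>v\<in>?U. (b - 1) * b ^ ?N i v)"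
      using sum.inter_restrict[OF finV, of "\<lambda>v. (b - 1) * b ^ ?N i v" ?U] UV by (simp add: Int_absorb1)
    also have "\<dots> = (\<Sum>j<r. \<Sum>v\<in>W j. (b - 1) * b ^ ?N i v)"
    proof (rule sum.UNION_disjoint)
      show "\<forall>j\<in>{..<r}. finite (W j)"
      proof
        fix j assume "j \<in> {..<r}"
        then have "W j \<subseteq> V" using UV by auto
        then show "finite (W j)" using finV finite_subset by blast
      qed
    qed (use Wdisj in \<open>auto simp: disjoint_family_on_def\<close>)
    also have "\<dots> = (\<Sum>j<r. real (width W) * ((b - 1) * b ^ t j i))"
    proof (rule sum.cong[OF refl])
      fix j assume j: "j \<in> {..<r}"
      have "(\<Sum>v\<in>W j. (b - 1) * b ^ ?N i v) = (\<Sum>v\<in>W j. (b - 1) * b ^ t j i)"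
      proof (rule sum.cong[OF refl])
        fix v assume "v \<in> W j"
        then have "?N i v = t j i" using t(1)[of j i v] W(1)[of j] i(1) j by auto
        then show "(b - 1) * b ^ ?N i v = (b - 1) * b ^ t j i" by simp
      qed
      also have "\<dots> = real (card (W j)) * ((b - 1) * b ^ t j i)" by (rule sum_constant)
      finally show "(\<Sum>v\<in>W j. (b - 1) * b ^ ?N i v) = real (width W) * ((b - 1) * b ^ t j i)"
        using W(1)[of j] j w by simp
    qed
    also have "\<dots> = real (width W) * ((b - 1) * (\<Sum>j<r. b ^ t j i))" by (simp add: sum_distrib_left)
    finally have new: "(\<Sum>v\<in>V. b ^ load r (W # L i) v) = ?\<Phi> i + real (width W) * ((b - 1) * (\<Sum>j<r. b ^ t j i))" .
    have \<Phi>0: "0 \<le> ?\<Phi> i" by (rule sum_nonneg) (use par(6) in auto)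
    have "(1 - \<theta>) * real n * ((b - 1) * (\<Sum>j<r. b ^ t j i)) \<le> (b - 1) * ((real r + real q - 1) * ?\<Phi> i)"
      using mult_left_mono[OF light[OF i(1)], of "b - 1"] par(6) by (simp add: mult_ac)
    also have "\<dots> \<le> \<alpha> * ((1 - \<theta>) * real n) * ?\<Phi> i"
      using mult_right_mono[OF \<alpha>(1) \<Phi>0] by (simp add: mult_ac)
    finally have "(1 - \<theta>) * real n * ((b - 1) * (\<Sum>j<r. b ^ t j i)) \<le> (1 - \<theta>) * real n * (\<alpha> * ?\<Phi> i)"
      by (simp add: mult_ac)
    moreover have "0 < (1 - \<theta>) * real n" using par(5,7) by simp
    ultimately have "(b - 1) * (\<Sum>j<r. b ^ t j i) \<le> \<alpha> * ?\<Phi> i" by (simp add: mult_le_cancel_left_pos)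
    then have "?\<Phi> i + real (width W) * ((b - 1) * (\<Sum>j<r. b ^ t j i)) \<le> ?\<Phi> i + real (width W) * (\<alpha> * ?\<Phi> i)"
      by (intro add_left_mono mult_left_mono) auto
    also have "\<dots> = ?\<Phi> i * (1 + \<alpha> * real (width W))" by (simp add: algebra_simps)
    also have "\<dots> \<le> ?\<Phi> i * exp (\<alpha> * real (width W))" by (intro mult_left_mono \<Phi>0 exp_ge_add_one_self)
    also have "\<dots> \<le> (real n * exp (\<alpha> * real (\<Sum>W\<leftarrow>L i. width W))) * exp (\<alpha> * real (width W))"
      by (intro mult_right_mono Li(1)[OF i(1)]) auto
    also have "\<dots> = real n * exp (\<alpha> * real (\<Sum>W\<leftarrow>W # L i. width W))"
      by (simp add: exp_add[symmetric] algebra_simps)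
    finally show ?thesis unfolding new .
  qed
  ultimately have "admissible r q h K m b \<alpha> V E c ?L"
    using L rich mw G(2) by (auto simp: admissible_def)
  then show ?thesis using i(1) by blast
qed

text \<open>
  Each round adds at least \<open>m\<close> to the total width of one of the \<open>q\<close> colours, so \<open>T\<close> rounds cannot pass
  with all totals at most \<open>\<tau>\<close>.
\<close>

lemma admissible_reaching_target:
  fixes b \<alpha> \<tau> :: real
  assumes "admissible r q h K m b \<alpha> V E c (\<lambda>_. [])"
    and "1 \<le> m"
    and extend: "\<And>L. admissible r q h K m b \<alpha> V E c L \<Longrightarrow> (\<And>i. i < q \<Longrightarrow> real (\<Sum>W\<leftarrow>L i. width W) \<le> \<tau>)
      \<Longrightarrow> \<exists>i<q. \<exists>W. admissible r q h K m b \<alpha> V E c (L(i := W # L i))"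
    and T: "real q * \<tau> < real T * real m"
  shows "\<exists>L i. admissible r q h K m b \<alpha> V E c L \<and> i < q \<and> \<tau> < real (\<Sum>W\<leftarrow>L i. width W) \<and> length (L i) \<le> T"
proof (rule ccontr)
  assume "\<not> ?thesis"
  then have below: "real (\<Sum>W\<leftarrow>L i. width W) \<le> \<tau>"
    if "admissible r q h K m b \<alpha> V E c L" "i < q" "length (L i) \<le> T" for L i
    using that not_le by blast
  have "\<exists>L. admissible r q h K m b \<alpha> V E c L \<and> (\<Sum>i<q. length (L i)) = k" if "k \<le> T" for k
    using that
  proof (induction k)
    case 0
    show ?case by (rule exI[of _ "\<lambda>_. []"]) (simp add: assms(1))
  next
    case (Suc k)
    have "k \<le> T" using Suc.prems by simp
    then obtain L where L: "admissible r q h K m b \<alpha> V E c L" "(\<Sum>i<q. length (L i)) = k"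
      using Suc.IH by blast
    have "length (L i) \<le> T" if "i < q" for i
      using member_le_sum[of i "{..<q}" "\<lambda>i. length (L i)"] that L(2) \<open>k \<le> T\<close> by simp
    then obtain i W where i: "i < q" and W: "admissible r q h K m b \<alpha> V E c (L(i := W # L i))"
      using extend[OF L(1)] below[OF L(1)] by blast
    have "(\<Sum>j<q. length ((L(i := W # L i)) j)) = (\<Sum>j<q. length (L j) + (if j = i then 1 else 0))"
      by (rule sum.cong) auto
    also have "\<dots> = Suc k" using i L(2) by (simp add: sum.distrib)
    finally show ?case using W by blast
  qed
  then obtain L where L: "admissible r q h K m b \<alpha> V E c L" "(\<Sum>i<q. length (L i)) = T" by blast
  have "real m * real (length (L i)) \<le> \<tau>" if i: "i < q" for i
  proof -
    have "length (L i) \<le> T"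
      using member_le_sum[of i "{..<q}" "\<lambda>i. length (L i)"] i L(2) by simp
    then have "real (\<Sum>W\<leftarrow>L i. width W) \<le> \<tau>" by (rule below[OF L(1) i])
    moreover have "(\<Sum>W\<leftarrow>L i. m) \<le> (\<Sum>W\<leftarrow>L i. width W)"
      by (rule sum_list_mono) (use L(1) i in \<open>auto simp: admissible_def\<close>)
    then have "m * length (L i) \<le> (\<Sum>W\<leftarrow>L i. width W)" by (simp add: sum_list_triv mult.commute)
    then have "real m * real (length (L i)) \<le> real (\<Sum>W\<leftarrow>L i. width W)" by (metis of_nat_le_iff of_nat_mult)
    ultimately show ?thesis by linarith
  qed
  then have "(\<Sum>i<q. real m * real (length (L i))) \<le> (\<Sum>i<q. \<tau>)" by (intro sum_mono) auto
  moreover have "(\<Sum>i<q. real m * real (length (L i))) = real T * real m"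
    using L(2) by (simp add: mult.commute flip: sum_distrib_left of_nat_sum)
  ultimately show False using T by simp
qed

section \<open>Large monochromatic matchings\<close>

text \<open>
  With \<open>z = \<sigma>\<^sup>2 / 2\<close>, the inequality \<open>1 + z \<ge> exp (z - z\<^sup>2)\<close> bounds the left-hand side by
  \<open>q * exp (- (K * \<sigma> ^ 4 / 4))\<close>. This value of \<open>z\<close> makes \<open>z * \<sigma>\<^sup>2 - z\<^sup>2\<close> as large as possible.
\<close>

lemma saturation_bound:
  fixes \<sigma> :: real
  assumes \<sigma>: "0 < \<sigma>" "\<sigma> \<le> 1" and K: "16 * real q / \<sigma> ^ 5 \<le> real K" "1 \<le> K"
  shows "real q * exp (\<sigma>\<^sup>2 / 2 * (1 - \<sigma>\<^sup>2) * real K) / (1 + \<sigma>\<^sup>2 / 2) ^ K \<le> \<sigma> / 4"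
proof -
  define z where "z = \<sigma>\<^sup>2 / 2"
  have z: "0 < z" "z \<le> 1" using \<sigma> power_le_one[of \<sigma> 2] by (simp_all add: z_def)
  have "z - z\<^sup>2 \<le> ln (1 + z)" by (rule ln_one_plus_pos_lower_bound) (use z in auto)
  then have "exp (z - z\<^sup>2) \<le> 1 + z" using z by (simp add: ln_ge_iff)
  then have "exp (z - z\<^sup>2) ^ K \<le> (1 + z) ^ K" by (intro power_mono) auto
  then have bK: "exp (real K * (z - z\<^sup>2)) \<le> (1 + z) ^ K" by (simp add: exp_of_nat_mult)
  define x where "x = real K * \<sigma> ^ 4 / 4"
  have x: "0 < x" using K \<sigma> by (simp add: x_def)
  have "z * (1 - \<sigma>\<^sup>2) * real K = real K * (z - z\<^sup>2) - x"
    by (simp add: z_def x_def power2_eq_square power4_eq_xxxx field_simps)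
  then have "exp (z * (1 - \<sigma>\<^sup>2) * real K) = exp (real K * (z - z\<^sup>2)) / exp x" by (simp add: exp_diff)
  also have "\<dots> \<le> (1 + z) ^ K / exp x" by (intro divide_right_mono bK) auto
  also have "\<dots> \<le> (1 + z) ^ K / x"
  proof (rule divide_left_mono)
    show "x \<le> exp x" using exp_ge_add_one_self[of x] by linarith
  qed (use x z in auto)
  finally have "exp (z * (1 - \<sigma>\<^sup>2) * real K) / (1 + z) ^ K \<le> 1 / x"
    using z x by (simp add: field_simps)
  then have "real q * (exp (z * (1 - \<sigma>\<^sup>2) * real K) / (1 + z) ^ K) \<le> real q * (1 / x)"
    by (rule mult_left_mono) auto
  also have "real q * (1 / x) \<le> \<sigma> / 4"
  proof -
    have "16 * real q \<le> real K * \<sigma> ^ 5" using K \<sigma> by (simp add: field_simps)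
    also have "\<dots> = 4 * \<sigma> * x" by (simp add: x_def eval_nat_numeral)
    finally show ?thesis using x by (simp add: field_simps)
  qed
  finally show ?thesis by (simp add: z_def)
qed

theorem theorem1p3:
  fixes r q :: nat and \<mu> :: real
  assumes "r \<ge> 2" and "q \<ge> 2" and "\<mu> > 0"
  shows "\<exists>\<epsilon>>0. \<exists>N::nat. \<forall>n\<ge>N. \<forall>(V :: 'v set) E c.
    r_graph r V E \<and> card V = n \<and> edge_colouring q E c
      \<and> real (card E) \<ge> (1 - \<epsilon>) * real (n choose r) \<longrightarrow>
    (\<exists>M. matching E M \<and> monochromatic c M
      \<and> real (card M) \<ge> (1 - \<mu>) * (real n / (real r + real q - 1)))"
proof -
  \<comment> \<open>The relative losses below are \<open>\<sigma>\<close> (target), \<open>\<sigma> / 2\<close> (greedy remainder) and \<open>\<sigma> / 2\<close> (rounding, for large \<open>n\<close>).\<close>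
  define \<sigma> where "\<sigma> = min \<mu> 1 / 2"
  define s where "s = real r + real q - 1"
  define b where "b = 1 + \<sigma>\<^sup>2 / 2"
  have \<sigma>: "0 < \<sigma>" "\<sigma> \<le> 1 / 2" "2 * \<sigma> \<le> \<mu>" using assms(3) by (auto simp: \<sigma>_def)
  have s: "1 \<le> s" using assms(1,2) by (simp add: s_def)
  have b: "1 < b" using \<sigma> by (simp add: b_def)
  obtain K0 :: nat where K0: "16 * real q / \<sigma> ^ 5 \<le> real K0" using real_arch_simple by blast
  define K where "K = Suc K0"
  have K: "16 * real q / \<sigma> ^ 5 \<le> real K" "1 \<le> K" using K0 by (auto simp: K_def)
  obtain h0 :: nat where h0: "2 * real K / \<sigma> \<le> real h0" using real_arch_simple by blast
  define h where "h = h0 + 2"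
  have h: "2 \<le> h" "2 * real K / \<sigma> \<le> real h" using h0 by (auto simp: h_def)
  have hr: "1 < real h ^ r" using h(1) assms(1) by (simp add: one_less_power)
  then have "1 < real h ^ r / (real h ^ r - 1)" by simp
  then obtain P where "2 * real q < (real h ^ r / (real h ^ r - 1)) ^ P" using real_arch_pow by blast
  then have P: "1 < 1 / (2 * real q) * (real h ^ r / (real h ^ r - 1)) ^ P"
    using assms(2) mult_strict_left_mono[of "2 * real q" _ "1 / (2 * real q)"] by simp
  \<comment> \<open>Of the fraction \<open>\<theta> = \<sigma> / 2\<close> of discarded vertices, one half is allotted to small types; this fixes \<open>\<delta>\<close>.\<close>
  define D where "D = K ^ q * (r * h ^ P)"
  define \<delta> where "\<delta> = \<sigma> / (4 * real D)"
  have pos: "0 < real D" using K h assms(1) by (simp add: D_def)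
  have \<delta>: "0 < \<delta>" using \<sigma> pos by (simp add: \<delta>_def)
  obtain T :: nat where T: "2 * real q * real K / \<delta> < real T" using reals_Archimedean2 by blast
  define C where "C = real T * (2 ^ (T * r) + 2)"
  have C: "0 \<le> C" by (simp add: C_def)
  define \<epsilon> where "\<epsilon> = (\<delta> / 2) ^ r / 2"
  have \<epsilon>: "0 < \<epsilon>" using \<delta> by (simp add: \<epsilon>_def)
  obtain N :: nat where N: "max (2 / \<delta>) (2 * C * s / \<sigma>) + 1 \<le> real N" using real_arch_simple by blast
  have main: "\<exists>M. matching E M \<and> monochromatic c M \<and> (1 - \<mu>) * (real n / (real r + real q - 1)) \<le> real (card M)"
    if "N \<le> n" and G: "r_graph r V E" "card V = n" "edge_colouring q E c"
      and dense: "(1 - \<epsilon>) * real (n choose r) \<le> real (card E)" for n and V :: "'v set" and E c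
  proof -
    have nN: "max (2 / \<delta>) (2 * C * s / \<sigma>) + 1 \<le> real n" using N that(1) by linarith
    then have n1: "2 / \<delta> \<le> real n" and n2: "2 * C * s / \<sigma> \<le> real n" by auto
    have "0 < real n" using n1 \<delta> by (smt (verit) divide_pos_pos)
    then have n0: "0 < n" by simp
    have n1': "2 \<le> \<delta> * real n" using n1 \<delta> by (simp add: field_simps)
    define m where "m = nat \<lfloor>\<delta> * real n\<rfloor>"
    have m: "real m \<le> \<delta> * real n" "\<delta> * real n / 2 \<le> real m" "1 \<le> m"
      using n1' unfolding m_def by linarith+
    \<comment> \<open>The factor \<open>1 + \<sigma>\<close> in \<open>\<alpha>\<close> pays for \<open>1 / (1 - \<theta>)\<close>; together with \<open>1 - \<sigma>\<close> in \<open>\<tau>\<close> it still leaves \<open>\<alpha> * \<tau> = \<sigma>\<^sup>2 / 2 * (1 - \<sigma>\<^sup>2) * K\<close>, a little less than \<open>K * ln b\<close>.\<close>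
    define \<tau> where "\<tau> = (1 - \<sigma>) * real K * real n / s"
    define \<alpha> where "\<alpha> = \<sigma>\<^sup>2 / 2 * (1 + \<sigma>) * s / real n"
    have small: "\<epsilon> * real n ^ r \<le> real (m * h ^ P) ^ r / 2"
    proof -
      have "\<epsilon> * real n ^ r = (\<delta> * real n / 2) ^ r / 2" by (simp add: \<epsilon>_def power_mult_distrib power_divide)
      also have "(\<delta> * real n / 2) ^ r \<le> real (m * h ^ P) ^ r"
      proof (rule power_mono)
        have "m * 1 \<le> m * h ^ P" using h(1) by (intro mult_le_mono2) simp
        then have "real m \<le> real (m * h ^ P)" by (simp only: of_nat_le_iff)
        then show "\<delta> * real n / 2 \<le> real (m * h ^ P)" using m(2) by linarith
      qed (use \<delta> in auto)
      finally show ?thesis by simp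
    qed
    have few: "real q * exp (\<alpha> * \<tau>) / b ^ K * real n + real (K ^ q * (r * (m * h ^ P))) \<le> \<sigma> / 2 * real n"
    proof -
      have "\<alpha> * \<tau> = \<sigma>\<^sup>2 / 2 * (1 - \<sigma>\<^sup>2) * real K"
        using s n0 by (simp add: \<alpha>_def \<tau>_def power2_eq_square field_simps)
      then have "real q * exp (\<alpha> * \<tau>) / b ^ K \<le> \<sigma> / 4"
        unfolding b_def by (simp only:) (rule saturation_bound[OF \<sigma>(1) _ K], use \<sigma>(2) in simp)
      then have "real q * exp (\<alpha> * \<tau>) / b ^ K * real n \<le> \<sigma> / 4 * real n" by (rule mult_right_mono) simp
      moreover have "real (K ^ q * (r * (m * h ^ P))) \<le> \<sigma> / 4 * real n"
      proof -
        have "real (K ^ q * (r * (m * h ^ P))) = real D * real m" by (simp add: D_def)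
        also have "\<dots> \<le> real D * (\<delta> * real n)" by (intro mult_left_mono m(1)) simp
        also have "\<dots> = \<sigma> / 4 * real n" using pos by (simp add: \<delta>_def field_simps)
        finally show ?thesis .
      qed
      ultimately show ?thesis by linarith
    qed
    have \<alpha>: "(b - 1) * (real r + real q - 1) \<le> \<alpha> * ((1 - \<sigma> / 2) * real n)" "0 \<le> \<alpha>"
    proof -
      have "0 \<le> \<sigma> * (1 - \<sigma>)" using \<sigma> by simp
      then have "1 \<le> (1 + \<sigma>) * (1 - \<sigma> / 2)" by (simp add: algebra_simps)
      then have "(\<sigma>\<^sup>2 / 2 * s) * 1 \<le> (\<sigma>\<^sup>2 / 2 * s) * ((1 + \<sigma>) * (1 - \<sigma> / 2))"
        using s by (intro mult_left_mono) auto
      also have "\<dots> = \<alpha> * ((1 - \<sigma> / 2) * real n)" using n0 by (simp add: \<alpha>_def)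
      finally show "(b - 1) * (real r + real q - 1) \<le> \<alpha> * ((1 - \<sigma> / 2) * real n)" by (simp add: b_def s_def)
      show "0 \<le> \<alpha>" using \<sigma> s by (simp add: \<alpha>_def)
    qed
    have start: "admissible r q h K m b \<alpha> V E c (\<lambda>_. [])"
      by (simp add: admissible_def load_def)
    have many: "real q * \<tau> < real T * real m"
    proof -
      have "\<tau> \<le> real K * real n"
      proof -
        have "(1 - \<sigma>) * real K * real n \<le> 1 * real K * real n" using \<sigma> by (intro mult_right_mono) auto
        also have "\<dots> \<le> real K * real n * s" using mult_left_mono[OF s, of "real K * real n"] by simp
        finally show ?thesis using s by (simp add: \<tau>_def divide_le_eq)
      qed
      then have "real q * \<tau> \<le> real q * (real K * real n)" by (rule mult_left_mono) simp
      also have "\<dots> < real T * (\<delta> * real n / 2)"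
        using T \<delta> n0 by (simp add: field_simps)
      also have "\<dots> \<le> real T * real m" by (intro mult_left_mono m(2)) simp
      finally show ?thesis .
    qed
    obtain L i where L: "admissible r q h K m b \<alpha> V E c L" and i: "i < q"
      and S: "\<tau> < real (\<Sum>W\<leftarrow>L i. width W)" and len: "length (L i) \<le> T"
    proof -
      have "\<exists>L i. admissible r q h K m b \<alpha> V E c L \<and> i < q \<and> \<tau> < real (\<Sum>W\<leftarrow>L i. width W) \<and> length (L i) \<le> T"
      proof (rule admissible_reaching_target[OF start m(3) _ many])
        fix L assume "admissible r q h K m b \<alpha> V E c L" "\<And>i. i < q \<Longrightarrow> real (\<Sum>W\<leftarrow>L i. width W) \<le> \<tau>"
        then show "\<exists>i<q. \<exists>W. admissible r q h K m b \<alpha> V E c (L(i := W # L i))"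
          by (intro extend_admissible[where \<theta> = "\<sigma> / 2" and \<tau> = \<tau> and \<epsilon> = \<epsilon> and P = P and n = n]
              G dense small h(1) m(3) n0 b P few \<alpha>)
            (use assms \<sigma> \<epsilon> in auto)
      qed
      then show ?thesis using that by blast
    qed
    have finV: "finite V" using G(1) by (simp add: r_graph_def)
    have rich: "rich_tuple r h {e\<in>E. c e = i} V W" if "W \<in> set (L i)" for W
      using L i that by (auto simp: admissible_def)
    have ld: "load r (L i) v \<le> K" for v using L i by (auto simp: admissible_def)
    let ?S = "real (\<Sum>W\<leftarrow>L i. width W)" and ?l = "length (L i)"
    obtain M where M: "M \<subseteq> {e\<in>E. c e = i}" "pairwise disjnt M"
      "?S * (1 / real K - 1 / real h) - real ?l * (2 ^ (?l * r) + 2) \<le> real (card M)"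
      using matching_from_rich_tuples[of r h K V "L i" "{e\<in>E. c e = i}"] assms(1) h(1) K(2) finV rich ld
      by auto
    have "real ?l * (2 ^ (?l * r) + 2) \<le> C"
      unfolding C_def using len by (intro mult_mono add_right_mono power_increasing) auto
    moreover have "(1 - 3 / 2 * \<sigma>) * (real n / s) \<le> ?S * (1 / real K - 1 / real h)"
    proof -
      have K0: "0 < real K" using K(2) by simp
      have h0: "0 < real h" using h(1) by simp
      have "1 / real h \<le> \<sigma> / 2 / real K" using h(2) \<sigma>(1) K0 h0 by (simp add: field_simps)
      then have gap: "(1 - \<sigma> / 2) / real K \<le> 1 / real K - 1 / real h" by (simp add: diff_divide_distrib)
      have "(1 - 3 / 2 * \<sigma>) * (real n / s) \<le> ((1 - \<sigma>) * (1 - \<sigma> / 2)) * (real n / s)"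
        using s \<sigma> by (intro mult_right_mono) (auto simp: algebra_simps)
      also have "\<dots> = \<tau> * ((1 - \<sigma> / 2) / real K)" using K0 s by (simp add: \<tau>_def)
      also have "\<dots> \<le> ?S * ((1 - \<sigma> / 2) / real K)"
        using S \<sigma> by (intro mult_right_mono) auto
      also have "\<dots> \<le> ?S * (1 / real K - 1 / real h)" by (intro mult_left_mono gap) simp
      finally show ?thesis .
    qed
    moreover have "C \<le> \<sigma> / 2 * (real n / s)" using n2 \<sigma>(1) s by (simp add: field_simps)
    ultimately have "(1 - 2 * \<sigma>) * (real n / s) \<le> real (card M)"
      using M(3) by (simp add: algebra_simps)
    moreover have "(1 - \<mu>) * (real n / s) \<le> (1 - 2 * \<sigma>) * (real n / s)"
      using \<sigma>(3) s by (intro mult_right_mono) auto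
    ultimately have "(1 - \<mu>) * (real n / s) \<le> real (card M)" by linarith
    moreover have "matching E M" "monochromatic c M"
      using M(1,2) by (auto simp: matching_def monochromatic_def)
    ultimately show ?thesis by (auto simp: s_def)
  qed
  show ?thesis
  proof (intro exI[of _ \<epsilon>] exI[of _ N] conjI \<epsilon> allI impI, elim conjE)
    fix n and V :: "'v set" and E c
    assume "N \<le> n" "r_graph r V E" "card V = n" "edge_colouring q E c"
      "(1 - \<epsilon>) * real (n choose r) \<le> real (card E)"
    then show "\<exists>M. matching E M \<and> monochromatic c M \<and> (1 - \<mu>) * (real n / (real r + real q - 1)) \<le> real (card M)"
      by (rule main)
  qed
qed

end
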